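(* Let $D_{2m}=\langle r,s\mid r^m=s^2=1,\ srs=r^{-1}\rangle$ be the dihedral group and let $\varphi,\psi:D_{2m}\to S_n$ be homomorphisms that are generator-conjugate with respect to $r,s$ and satisfy $\varphi(r)=\psi(r)=\sigma$. Write $\sigma=\sigma_1\cdots\sigma_l$, where $\sigma_i$ is the product of all the $k_i$ cycles of length $d_i$ in the disjoint cycle decomposition of $\sigma$ and $d_1,\dots,d_l\ge2$ are distinct, and write $\varphi(s)=\mu\pi_1\cdots\pi_l$, $\psi(s)=\mu'\pi_1'\cdots\pi_l'$ with $\mu,\mu'\in S_{\mathbf{Fix}(\sigma)}$ and $\pi_i,\pi_i'\in H_{\sigma_i}$. Then $\varphi,\psi$ are conjugate if and only if: (i) $\mu,\mu'$ are conjugate in $S_n$; and (ii) for every $1\le i\le l$, $\pi_i,\pi_i'$ are conjugate in $S_n$ and their images in $H_{\sigma_i}/K_{H_{\sigma_i}}\cong S_{k_i}$ have the same cycle type.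
   Context: $S_n$ is the symmetric group of $\{1,\dots,n\}$ and $S_X$ that of a set $X$; for $X\subseteq\{1,\dots,n\}$, $S_X$ is regarded as a subgroup of $S_n$. $\mathbf{Fix}(\sigma)$ is the set of fixed points of $\sigma$ and $X_\sigma=\{1,\dots,n\}\setminus\mathbf{Fix}(\sigma)$. Homomorphisms $\varphi,\psi:G\to H$ are generator-conjugate with respect to generators $g_1,\dots,g_r$ of $G$ if for each $i$ there is $h\in H$ (depending on $i$) with $h\varphi(g_i)h^{-1}=\psi(g_i)$. They are conjugate if there is a single $h\in H$ with $h\varphi(g)h^{-1}=\psi(g)$ for all $g\in G$. $H_{\sigma_i}=\{x\in S_{X_{\sigma_i}} : x\sigma_ix^{-1}=\sigma_i^z \text{ for some } z\in\mathbb{Z}\}$. If $\sigma_i=\tau_1\cdots\tau_{k_i}$ is the decomposition into disjoint cycles of length $d_i$, then $H_{\sigma_i}$ acts on the cycles by permuting their supports: $x$ sends index $j$ to $j'$ if $x$ maps the set of points of $\tau_j$ onto the set of points of $\tau_{j'}$. The kernel of this action is $K_{H_{\sigma_i}}=\{x\in H_{\sigma_i}: \text{for every } 1\le j\le k_i \text{ there is } z\in\mathbb{Z}\text{ with } x\tau_jx^{-1}=\tau_j^z\}$, and the action induces $H_{\sigma_i}/K_{H_{\sigma_i}}\cong S_{k_i}$. Since $\varphi(s)$ and $\psi(s)$ conjugate $\sigma$ to $\sigma^{-1}$, they preserve $\mathbf{Fix}(\sigma)$ and each $X_{\sigma_i}$; $\mu,\pi_1,\dots,\pi_l$ are the restrictions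 of $\varphi(s)$ to $\mathbf{Fix}(\sigma),X_{\sigma_1},\dots,X_{\sigma_l}$, and $\mu',\pi_1',\dots,\pi_l'$ are those of $\psi(s)$. *)

theory Defs
  imports
    "HOL-Algebra.Sym_Groups"
    "HOL-Combinatorics.Orbits"
    "HOL-Library.Multiset"
begin

section \<open>Groups given by generators and relations\<close>

text \<open>A word in the generators and their inverses: the letter \<open>(a, True)\<close> stands for \<open>a\<close>,
  the letter \<open>(a, False)\<close> for the inverse of \<open>a\<close>. A relation \<open>u = v\<close> is a pair of words.\<close>

type_synonym 'a word = "('a \<times> bool) list"

inductive pres_eq :: "('a word \<times> 'a word) set \<Rightarrow> 'a word \<Rightarrow> 'a word \<Rightarrow> bool"
  for R :: "('a word \<times> 'a word) set"
where
  refl: "pres_eq R u u"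
| sym: "pres_eq R u v \<Longrightarrow> pres_eq R v u"
| trans: "pres_eq R u v \<Longrightarrow> pres_eq R v w \<Longrightarrow> pres_eq R u w"
| append: "pres_eq R u u' \<Longrightarrow> pres_eq R v v' \<Longrightarrow> pres_eq R (u @ v) (u' @ v')"
| cancel: "pres_eq R [(a, b), (a, \<not> b)] []"
| relation: "(u, v) \<in> R \<Longrightarrow> pres_eq R u v"

definition pres_class :: "('a word \<times> 'a word) set \<Rightarrow> 'a word \<Rightarrow> 'a word set" where
  "pres_class R u = {v. pres_eq R u v}"

definition presented_group :: "('a word \<times> 'a word) set \<Rightarrow> 'a word set monoid" where
  "presented_group R =
    \<lparr> carrier = range (pres_class R),
      mult = (\<lambda>A B. \<Union>u\<in>A. \<Union>v\<in>B. pres_class R (u @ v)),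
      one = pres_class R [] \<rparr>"

definition inv_word :: "'a word \<Rightarrow> 'a word" where
  "inv_word w = rev (map (\<lambda>(a, b). (a, \<not> b)) w)"

lemma pres_class_eq_iff: "pres_class R u = pres_class R v \<longleftrightarrow> pres_eq R u v"
proof
  assume "pres_class R u = pres_class R v"
  then have "v \<in> pres_class R u"
    by (simp add: pres_class_def pres_eq.refl)
  then show "pres_eq R u v"
    by (simp add: pres_class_def)
next
  assume uv: "pres_eq R u v"
  have "pres_eq R u w \<longleftrightarrow> pres_eq R v w" for w
    using pres_eq.trans[OF uv] pres_eq.trans[OF pres_eq.sym[OF uv]] by blast
  then show "pres_class R u = pres_class R v"
    by (simp add: pres_class_def)
qed

lemma pres_eq_inv_word: "pres_eq R (inv_word w @ w) []"
proof (induction w)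
  case Nil
  then show ?case by (simp add: inv_word_def pres_eq.refl)
next
  case (Cons x w)
  obtain a b where x: "x = (a, b)" by (cases x)
  have "pres_eq R [(a, \<not> b), (a, b)] []"
    using pres_eq.cancel[of R a "\<not> b"] by simp
  then have "pres_eq R ([(a, \<not> b), (a, b)] @ w) ([] @ w)"
    by (rule pres_eq.append) (rule pres_eq.refl)
  then have "pres_eq R (inv_word w @ ([(a, \<not> b), (a, b)] @ w)) (inv_word w @ ([] @ w))"
    by (rule pres_eq.append[OF pres_eq.refl])
  then have "pres_eq R (inv_word w @ [(a, \<not> b), (a, b)] @ w) []"
    using Cons.IH pres_eq.trans[of R _ "inv_word w @ w" "[]"] by simp
  then show ?case by (simp add: inv_word_def x)
qed

lemma presented_group_mult:
  "pres_class R u \<otimes>\<^bsub>presented_group R\<^esub> pres_class R v = pres_class R (u @ v)"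
proof -
  have u: "u \<in> pres_class R u" and v: "v \<in> pres_class R v"
    by (auto simp: pres_class_def pres_eq.refl)
  have "pres_class R (u' @ v') = pres_class R (u @ v)"
    if "u' \<in> pres_class R u" "v' \<in> pres_class R v" for u' v'
    unfolding pres_class_eq_iff
    by (rule pres_eq.sym, rule pres_eq.append) (use that in \<open>simp_all add: pres_class_def\<close>)
  then have "(\<Union>u'\<in>pres_class R u. \<Union>v'\<in>pres_class R v. pres_class R (u' @ v')) =
      (\<Union>u'\<in>pres_class R u. \<Union>v'\<in>pres_class R v. pres_class R (u @ v))"
    by simp
  also have "\<dots> = pres_class R (u @ v)"
    using u v by blast
  finally show ?thesis
    by (simp add: presented_group_def)
qed

lemma presented_group_carrier: "carrier (presented_group R) = range (pres_class R)"
  by (simp add: presented_group_def)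

lemma presented_group_one: "\<one>\<^bsub>presented_group R\<^esub> = pres_class R []"
  by (simp add: presented_group_def)

lemma group_presented_group: "group (presented_group R)"
proof (rule groupI)
  fix x assume "x \<in> carrier (presented_group R)"
  then obtain u where u: "x = pres_class R u"
    by (auto simp: presented_group_carrier)
  have "pres_class R (inv_word u) \<otimes>\<^bsub>presented_group R\<^esub> x = \<one>\<^bsub>presented_group R\<^esub>"
    by (simp add: u presented_group_mult presented_group_one pres_class_eq_iff pres_eq_inv_word)
  then show "\<exists>y\<in>carrier (presented_group R).
      y \<otimes>\<^bsub>presented_group R\<^esub> x = \<one>\<^bsub>presented_group R\<^esub>"
    by (auto simp: presented_group_carrier)
qed (auto simp: presented_group_carrier presented_group_mult presented_group_one)


section \<open>The dihedral group\<close>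

datatype dihedral_gen = Rot | Refl

definition dihedral_relations :: "nat \<Rightarrow> (dihedral_gen word \<times> dihedral_gen word) set" where
  "dihedral_relations m =
    { (replicate m (Rot, True), []),
      ([(Refl, True), (Refl, True)], []),
      ([(Refl, True), (Rot, True), (Refl, True)], [(Rot, False)]) }"

text \<open>The dihedral group of order \<open>2 * m\<close>; the index is the order of the rotation, not of the
  group.\<close>

definition dihedral_group :: "nat \<Rightarrow> dihedral_gen word set monoid" where
  "dihedral_group m = presented_group (dihedral_relations m)"

definition dihedral_r :: "nat \<Rightarrow> dihedral_gen word set" where
  "dihedral_r m = pres_class (dihedral_relations m) [(Rot, True)]"

definition dihedral_s :: "nat \<Rightarrow> dihedral_gen word set" where
  "dihedral_s m = pres_class (dihedral_relations m) [(Refl, True)]"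

lemma group_dihedral_group: "group (dihedral_group m)"
  unfolding dihedral_group_def by (rule group_presented_group)

lemma generate_dihedral_group:
  "generate (dihedral_group m) {dihedral_r m, dihedral_s m} = carrier (dihedral_group m)"
proof
  interpret group "dihedral_group m" by (rule group_dihedral_group)
  let ?c = "pres_class (dihedral_relations m)"
  let ?S = "generate (dihedral_group m) {dihedral_r m, dihedral_s m}"
  have mult: "?c u \<otimes>\<^bsub>dihedral_group m\<^esub> ?c v = ?c (u @ v)" for u v
    by (simp add: dihedral_group_def presented_group_mult)
  have one: "\<one>\<^bsub>dihedral_group m\<^esub> = ?c []"
    by (simp add: dihedral_group_def presented_group_one)
  have car: "?c u \<in> carrier (dihedral_group m)" for u
    by (simp add: dihedral_group_def presented_group_carrier)
  show "?S \<subseteq> carrier (dihedral_group m)"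
    by (rule generate_incl) (auto simp: dihedral_r_def dihedral_s_def car)
  have pos: "?c [(a, True)] \<in> ?S" for a
    by (cases a) (auto simp: dihedral_r_def dihedral_s_def intro: generate.incl)
  have inv_eq: "inv\<^bsub>dihedral_group m\<^esub> ?c [(a, True)] = ?c [(a, False)]" for a
    using pres_eq.cancel[of "dihedral_relations m" a False]
    by (intro inv_equality car) (simp add: mult one pres_class_eq_iff)
  have neg: "?c [(a, False)] \<in> ?S" for a
    unfolding inv_eq[symmetric] using pos
    by (intro generate_m_inv_closed) (auto simp: dihedral_r_def dihedral_s_def car)
  have "?c w \<in> ?S" for w
  proof (induction w)
    case Nil
    then show ?case using generate.one[of "dihedral_group m"] by (simp add: one)
  next
    case (Cons x w)
    obtain a b where x: "x = (a, b)" by (cases x)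
    have "?c [x] \<in> ?S" using pos neg x by (cases b) auto
    then show ?case
      using generate.eng[OF _ Cons.IH, of "?c [x]"] by (simp add: mult)
  qed
  then show "carrier (dihedral_group m) \<subseteq> ?S"
    by (auto simp: dihedral_group_def presented_group_carrier)
qed


section \<open>Conjugacy of elements and of homomorphisms\<close>

definition conjugate_in :: "('b, 'c) monoid_scheme \<Rightarrow> 'b \<Rightarrow> 'b \<Rightarrow> bool" where
  "conjugate_in H x y \<longleftrightarrow> (\<exists>h\<in>carrier H. h \<otimes>\<^bsub>H\<^esub> x \<otimes>\<^bsub>H\<^esub> inv\<^bsub>H\<^esub> h = y)"

text \<open>Here \<open>S\<close> is the set of the chosen generators of the domain of the two homomorphisms.\<close>

definition generator_conjugate ::
  "('b, 'c) monoid_scheme \<Rightarrow> 'a set \<Rightarrow> ('a \<Rightarrow> 'b) \<Rightarrow> ('a \<Rightarrow> 'b) \<Rightarrow> bool" where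
  "generator_conjugate H S \<phi> \<psi> \<longleftrightarrow> (\<forall>g\<in>S. conjugate_in H (\<phi> g) (\<psi> g))"

definition conjugate_homs ::
  "('a, 'd) monoid_scheme \<Rightarrow> ('b, 'c) monoid_scheme \<Rightarrow> ('a \<Rightarrow> 'b) \<Rightarrow> ('a \<Rightarrow> 'b) \<Rightarrow> bool" where
  "conjugate_homs G H \<phi> \<psi> \<longleftrightarrow>
    (\<exists>h\<in>carrier H. \<forall>g\<in>carrier G. h \<otimes>\<^bsub>H\<^esub> \<phi> g \<otimes>\<^bsub>H\<^esub> inv\<^bsub>H\<^esub> h = \<psi> g)"


section \<open>Permutations of \<open>{1..n}\<close>\<close>

definition fixed_points :: "nat \<Rightarrow> (nat \<Rightarrow> nat) \<Rightarrow> nat set" where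
  "fixed_points n \<sigma> = {x \<in> {1..n}. \<sigma> x = x}"

definition moved_points :: "nat \<Rightarrow> (nat \<Rightarrow> nat) \<Rightarrow> nat set" where
  "moved_points n \<sigma> = {1..n} - fixed_points n \<sigma>"

text \<open>The nontrivial cycles of \<open>\<sigma>\<close>, each as a permutation of \<open>{1..n}\<close>. The length of a cycle \<open>c\<close>
  is \<open>card (moved_points n c)\<close>.\<close>

definition disjoint_cycles :: "nat \<Rightarrow> (nat \<Rightarrow> nat) \<Rightarrow> (nat \<Rightarrow> nat) set" where
  "disjoint_cycles n \<sigma> = (\<lambda>x. perm_restrict \<sigma> (orbit \<sigma> x)) ` moved_points n \<sigma>"

text \<open>The product \<open>f 1 \<circ> f 2 \<circ> \<dots> \<circ> f l\<close>.\<close>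

definition perm_prod :: "(nat \<Rightarrow> nat \<Rightarrow> nat) \<Rightarrow> nat \<Rightarrow> nat \<Rightarrow> nat" where
  "perm_prod f l = foldr (\<circ>) (map f [1..<Suc l]) id"

text \<open>The multiset of the cycle lengths of a permutation of \<open>{1..k}\<close>; a fixed point counts as a
  cycle of length 1.\<close>

definition cycle_type :: "nat \<Rightarrow> (nat \<Rightarrow> nat) \<Rightarrow> nat multiset" where
  "cycle_type k p = image_mset card (mset_set (orbit p ` {1..k}))"


section \<open>The groups \<open>H\<close> and \<open>K\<close> and the action on the cycles\<close>

text \<open>The symmetric group of a set \<open>X \<subseteq> {1..n}\<close> is the subgroup \<open>{x. x permutes X}\<close> of
  \<open>sym_group n\<close>. Below, \<open>\<rho>\<close> is a permutation of \<open>{1..n}\<close> whose nontrivial cycles are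
  \<open>\<tau> 1, \<dots>, \<tau> k\<close>.\<close>

definition H_set :: "nat \<Rightarrow> (nat \<Rightarrow> nat) \<Rightarrow> (nat \<Rightarrow> nat) set" where
  "H_set n \<rho> = {x. x permutes moved_points n \<rho> \<and>
     (\<exists>z::int. x \<otimes>\<^bsub>sym_group n\<^esub> \<rho> \<otimes>\<^bsub>sym_group n\<^esub> inv\<^bsub>sym_group n\<^esub> x = \<rho> [^]\<^bsub>sym_group n\<^esub> z)}"

definition H_group :: "nat \<Rightarrow> (nat \<Rightarrow> nat) \<Rightarrow> (nat \<Rightarrow> nat) monoid" where
  "H_group n \<rho> = (sym_group n)\<lparr>carrier := H_set n \<rho>\<rparr>"

definition K_set :: "nat \<Rightarrow> (nat \<Rightarrow> nat) \<Rightarrow> nat \<Rightarrow> (nat \<Rightarrow> nat \<Rightarrow> nat) \<Rightarrow> (nat \<Rightarrow> nat) set" where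
  "K_set n \<rho> k \<tau> = {x \<in> H_set n \<rho>. \<forall>j\<in>{1..k}.
     \<exists>z::int. x \<otimes>\<^bsub>sym_group n\<^esub> \<tau> j \<otimes>\<^bsub>sym_group n\<^esub> inv\<^bsub>sym_group n\<^esub> x = \<tau> j [^]\<^bsub>sym_group n\<^esub> z}"

text \<open>The permutation of the indices \<open>{1..k}\<close> by which \<open>x\<close> permutes the supports of the cycles.\<close>

definition cycle_action :: "nat \<Rightarrow> nat \<Rightarrow> (nat \<Rightarrow> nat \<Rightarrow> nat) \<Rightarrow> (nat \<Rightarrow> nat) \<Rightarrow> nat \<Rightarrow> nat" where
  "cycle_action n k \<tau> x = (\<lambda>j.
     if j \<in> {1..k}
     then (THE j'. j' \<in> {1..k} \<and> x ` moved_points n (\<tau> j) = moved_points n (\<tau> j'))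
     else j)"

text \<open>The image of \<open>x\<close> in the quotient \<open>H_group n \<rho> Mod K_set n \<rho> k \<tau>\<close>.\<close>

definition quotient_image ::
  "nat \<Rightarrow> (nat \<Rightarrow> nat) \<Rightarrow> nat \<Rightarrow> (nat \<Rightarrow> nat \<Rightarrow> nat) \<Rightarrow> (nat \<Rightarrow> nat) \<Rightarrow> (nat \<Rightarrow> nat) set" where
  "quotient_image n \<rho> k \<tau> x = K_set n \<rho> k \<tau> #>\<^bsub>H_group n \<rho>\<^esub> x"

text \<open>The map from \<open>H_group n \<rho> Mod K_set n \<rho> k \<tau>\<close> to \<open>sym_group k\<close> induced by the action:
  \<^const>\<open>cycle_action\<close> is constant on each coset.\<close>

definition induced_map :: "nat \<Rightarrow> nat \<Rightarrow> (nat \<Rightarrow> nat \<Rightarrow> nat) \<Rightarrow> (nat \<Rightarrow> nat) set \<Rightarrow> nat \<Rightarrow> nat" where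
  "induced_map n k \<tau> C = the_elem (cycle_action n k \<tau> ` C)"

end

theory Submission
  imports Defs
begin

text \<open>A homomorphism from the dihedral group to the symmetric group is an action on \<open>{1..n}\<close>, and
conjugate homomorphisms are isomorphic actions. Here both actions have the same rotation \<open>\<sigma>\<close>; let
\<open>p\<close> and \<open>q\<close> be the two reflections. So the question is when some permutation \<open>h\<close> commutes with
\<open>\<sigma>\<close> and conjugates \<open>p\<close> to \<open>q\<close>.

The orbits of such an action (here called blocks) are easy to classify. As \<open>p\<close> inverts \<open>\<sigma>\<close>, it
permutes the cycles of \<open>\<sigma>\<close> of each length \<open>d\<close>. A block is either a pair of \<open>d\<close>-cycles exchanged
by \<open>p\<close>, or a single \<open>d\<close>-cycle on which \<open>p\<close> is a reflection. Such a reflection either fixes a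
point or sends some point to its successor under \<open>\<sigma>\<close> (\<open>stable_base_point\<close>). Therefore \<open>d\<close>,
together with the answers to the questions whether \<open>p\<close> preserves the cycle and whether it fixes a
point of it, determines the block up to isomorphism (\<open>isomorphic_on_block\<close>), and two actions are
isomorphic if each kind of block occurs equally often. For a given \<open>\<sigma>\<close>, the numbers of blocks
of each kind are determined by two counts for each \<open>d\<close>: the fixed points of \<open>p\<close> in \<open>d\<close>-cycles, and the \<open>d\<close>-cycles
that \<open>p\<close> preserves (\<open>isomorphic_if_same_counts\<close>).

These counts are what the conditions of the theorem provide. The factors \<open>\<mu>\<close> and \<open>\<pi> i\<close> are the
restrictions of \<open>p\<close> to the points in cycles of length 1 and \<open>d i\<close>
(\<open>disjoint_factors_eq_perm_restrict\<close>), so their conjugacy gives the first count. The coset of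
\<open>\<pi> i\<close> acts on the indices of the cycles as \<open>p\<close> does (\<open>induced_map_quotient_image\<close>), and the
entries 1 of its cycle type give the second count. For \<open>d = 1\<close> both counts are the same.

Conversely, a permutation \<open>h\<close> that commutes with \<open>\<sigma>\<close> and conjugates \<open>p\<close> to \<open>q\<close> preserves the set
of points in cycles of each length. It conjugates the restrictions of \<open>p\<close> to those of \<open>q\<close>, and
the permutation of the indices that it induces conjugates the induced actions.\<close>

section \<open>Gluing isomorphisms of sets with two operators\<close>

text \<open>Isomorphism of sets \<open>A\<close> and \<open>B\<close>, each with two operators; this is isomorphism of dihedral group
actions when the operators are a rotation and a reflection. The operators may be defined beyond
\<open>A\<close> and \<open>B\<close>, so that the relation applies to invariant subsets without restricting them.\<close>

definition isomorphic_on ::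
  "('a \<Rightarrow> 'a) \<Rightarrow> ('a \<Rightarrow> 'a) \<Rightarrow> 'a set \<Rightarrow> ('b \<Rightarrow> 'b) \<Rightarrow> ('b \<Rightarrow> 'b) \<Rightarrow> 'b set \<Rightarrow> bool" where
  "isomorphic_on \<sigma> p A \<sigma>' q B \<longleftrightarrow>
    (\<exists>h. bij_betw h A B \<and> (\<forall>x\<in>A. h (\<sigma> x) = \<sigma>' (h x) \<and> h (p x) = q (h x)))"

text \<open>Operators that preserve a labelling act on each fibre separately, so isomorphisms of the fibres
combine. This is used with the kind of a point as label, and then with the block of a point.\<close>

lemma isomorphic_on_glue:
  assumes f: "\<And>x. x \<in> A \<Longrightarrow> f (\<sigma> x) = f x \<and> f (p x) = f x"
    and fibres: "\<And>t. isomorphic_on \<sigma> p {x \<in> A. f x = t} \<sigma>' q {y \<in> B. g y = t}"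
  shows "isomorphic_on \<sigma> p A \<sigma>' q B"
proof -
  have "\<forall>t. \<exists>h. bij_betw h {x \<in> A. f x = t} {y \<in> B. g y = t} \<and>
      (\<forall>x\<in>{x \<in> A. f x = t}. h (\<sigma> x) = \<sigma>' (h x) \<and> h (p x) = q (h x))"
    using fibres unfolding isomorphic_on_def by blast
  from choice[OF this] obtain H where H: "bij_betw (H t) {x \<in> A. f x = t} {y \<in> B. g y = t}"
    "\<forall>x\<in>{x \<in> A. f x = t}. H t (\<sigma> x) = \<sigma>' (H t x) \<and> H t (p x) = q (H t x)" for t
    by blast
  define h where "h x = H (f x) x" for x
  have h: "h x \<in> B" "g (h x) = f x" if "x \<in> A" for x
    using H(1)[of "f x"] that by (auto simp: h_def bij_betw_def)
  have "inj_on h A"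
  proof (rule inj_onI)
    fix x y assume xy: "x \<in> A" "y \<in> A" "h x = h y"
    then have "f x = f y" using h(2)[of x] h(2)[of y] by simp
    then show "x = y"
      using H(1)[of "f x"] xy by (auto simp: h_def bij_betw_def dest: inj_onD)
  qed
  moreover have "y \<in> h ` A" if y: "y \<in> B" for y
  proof -
    have "y \<in> H (g y) ` {x \<in> A. f x = g y}"
      using H(1)[of "g y"] y by (auto simp: bij_betw_def)
    then obtain x where "x \<in> A" "f x = g y" "y = H (g y) x" by blast
    then show ?thesis by (intro image_eqI[of _ _ x]) (simp_all add: h_def)
  qed
  ultimately have "bij_betw h A B"
    using h(1) by (auto simp: bij_betw_def)
  moreover have "h (\<sigma> x) = \<sigma>' (h x) \<and> h (p x) = q (h x)" if "x \<in> A" for x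
    using H(2)[of "f x"] f[OF that] that by (simp add: h_def)
  ultimately show ?thesis
    unfolding isomorphic_on_def by blast
qed

section \<open>Counting with fibres\<close>

lemma card_sum_fibres:
  assumes "finite S"
  shows "card S = (\<Sum>y\<in>f ` S. card {x \<in> S. f x = y})"
  using sum.image_gen[OF assms, of "\<lambda>_. 1::nat" f] by (simp only: card_eq_sum)

lemma card_image_times_fibre:
  assumes "finite S" "\<And>x. x \<in> S \<Longrightarrow> card {z \<in> S. f z = f x} = c"
  shows "card S = c * card (f ` S)"
proof -
  have "card S = (\<Sum>y\<in>f ` S. c)"
    unfolding card_sum_fibres[OF assms(1), of f] using assms(2) by (intro sum.cong) auto
  then show ?thesis by simp
qed

text \<open>If all fibres of both maps have one common size, then the number of fibres is the size of the
source divided by it. Comparing fibres of \<open>f\<close> only with fibres of \<open>g\<close> is enough, since a set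
that is nonempty on one side is nonempty on the other. It yields a common size without computing
it.\<close>

lemma card_image_eq_if_fibres:
  assumes S: "finite S" and T: "finite T" and ST: "card S = card T"
    and fibres: "\<And>x y. x \<in> S \<Longrightarrow> y \<in> T \<Longrightarrow> card {z \<in> S. f z = f x} = card {z \<in> T. g z = g y}"
  shows "card (f ` S) = card (g ` T)"
proof (cases "S = {}")
  case True
  then show ?thesis using T ST by simp
next
  case False
  then obtain x y where x: "x \<in> S" and y: "y \<in> T"
    using S ST by fastforce
  define c where "c = card {z \<in> S. f z = f x}"
  have "c > 0"
    unfolding c_def card_gt_0_iff using S x by auto
  have "card S = c * card (f ` S)"
    by (rule card_image_times_fibre[OF S]) (simp add: c_def fibres[OF _ y] x)
  moreover have "card T = c * card (g ` T)"
    by (rule card_image_times_fibre[OF T]) (simp add: c_def fibres[OF x])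
  ultimately show ?thesis using ST \<open>c > 0\<close> by simp
qed

section \<open>Matching cycles of equal length\<close>

lemma funpow_eq_iff_mod_card_orbit:
  assumes a: "a \<in> orbit f a"
  shows "(f ^^ i) a = (f ^^ j) a \<longleftrightarrow> i mod card (orbit f a) = j mod card (orbit f a)"
proof -
  define d where "d = funpow_dist1 f a a"
  have inj: "inj_on (\<lambda>n. (f ^^ n) a) {0..<d}"
    unfolding d_def by (rule inj_on_funpow_dist1[OF a])
  have orb: "orbit f a = (\<lambda>n. (f ^^ n) a) ` {0..<d}"
    unfolding d_def by (rule orbit_conv_funpow_dist1[OF a])
  have card: "card (orbit f a) = d"
    unfolding orb using card_image[OF inj] by simp
  have "(f ^^ d) a = a"
    unfolding d_def by (rule funpow_dist1_prop[OF a])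
  then have red: "(f ^^ (n mod d)) a = (f ^^ n) a" for n
    by (rule funpow_mod_eq)
  have "i mod d \<in> {0..<d}" "j mod d \<in> {0..<d}"
    by (simp_all add: d_def)
  then have "(f ^^ (i mod d)) a = (f ^^ (j mod d)) a \<longleftrightarrow> i mod d = j mod d"
    using inj by (auto dest: inj_onD)
  then show ?thesis by (simp add: red card)
qed

lemma ex_cycle_bijection:
  assumes a: "a \<in> orbit f a" and b: "b \<in> orbit g b"
    and card: "card (orbit f a) = card (orbit g b)"
  obtains h where "bij_betw h (orbit f a) (orbit g b)" "h a = b"
    "\<And>x. x \<in> orbit f a \<Longrightarrow> h (f x) = g (h x)"
proof -
  \<comment> \<open>\<open>f\<^sup>i a\<close> goes to \<open>g\<^sup>i b\<close>; the choice of the exponent \<open>i\<close> is immaterial because it is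
    determined modulo the common length of the cycles.\<close>
  define h where "h y = (g ^^ (SOME i. (f ^^ i) a = y)) b" for y
  have h: "h ((f ^^ i) a) = (g ^^ i) b" for i
  proof -
    have "(f ^^ (SOME j. (f ^^ j) a = (f ^^ i) a)) a = (f ^^ i) a"
      by (rule someI[of _ i]) simp
    then show ?thesis
      unfolding h_def funpow_eq_iff_mod_card_orbit[OF a] funpow_eq_iff_mod_card_orbit[OF b] card .
  qed
  have fa: "orbit f a = range (\<lambda>n. (f ^^ n) a)" and gb: "orbit g b = range (\<lambda>n. (g ^^ n) b)"
    using orbit_altdef_self_in[OF a] orbit_altdef_self_in[OF b] by auto
  have "inj_on h (orbit f a)"
    unfolding fa
    by (auto simp: inj_on_def h funpow_eq_iff_mod_card_orbit[OF a]
        funpow_eq_iff_mod_card_orbit[OF b] card)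
  moreover have "h ` orbit f a = orbit g b"
    by (simp add: fa gb image_image h)
  moreover have "h (f x) = g (h x)" if "x \<in> orbit f a" for x
  proof -
    from \<open>x \<in> orbit f a\<close> obtain i where "x = (f ^^ i) a" unfolding fa by auto
    then show ?thesis using h[of i] h[of "Suc i"] by simp
  qed
  moreover have "h a = b" using h[of 0] by simp
  ultimately show thesis using that by (auto simp: bij_betw_def)
qed

section \<open>Dihedral actions and their blocks\<close>

text \<open>An action of the infinite dihedral group on a finite set, given by a rotation \<open>\<sigma>\<close> and a
reflection \<open>p\<close>. The relation \<open>p\<sigma>p = \<sigma>\<^sup>-\<^sup>1\<close> is written without inverses as \<open>\<sigma>p\<sigma> = p\<close>.\<close>

locale dihedral_action =
  fixes X :: "'a set" and \<sigma> p :: "'a \<Rightarrow> 'a"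
  assumes finite_X: "finite X"
    and \<sigma>: "\<sigma> permutes X"
    and p: "p permutes X"
    and involution: "p (p x) = x"
    and inversion: "\<sigma> (p (\<sigma> x)) = p x"
begin

lemma self_in_orbit: "x \<in> orbit \<sigma> x"
  using \<sigma> finite_X by (intro permutation_self_in_orbit) (auto simp: permutation_permutes)

lemma orbit_eq: "y \<in> orbit \<sigma> x \<Longrightarrow> orbit \<sigma> y = orbit \<sigma> x"
  by (meson cyclic_on_orbit[OF \<sigma> finite_X] orbit_cyclic_eq3)

lemma orbit_eq_iff: "orbit \<sigma> y = orbit \<sigma> x \<longleftrightarrow> y \<in> orbit \<sigma> x"
  using orbit_eq self_in_orbit by metis

lemma orbit_step_eq: "orbit \<sigma> (\<sigma> x) = orbit \<sigma> x"
  by (rule orbit_eq) (rule orbit.base)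

lemma orbit_subset_X: "x \<in> X \<Longrightarrow> orbit \<sigma> x \<subseteq> X"
  by (rule permutes_orbit_subset[OF \<sigma>])

lemma p_in_orbit: "y \<in> orbit \<sigma> x \<Longrightarrow> p y \<in> orbit \<sigma> (p x)"
proof (induction rule: orbit.induct)
  case base
  have "p x \<in> orbit \<sigma> (p (\<sigma> x))"
    using orbit.base[of \<sigma> "p (\<sigma> x)"] inversion by simp
  then show ?case using orbit_eq_iff by metis
next
  case (step y)
  have "p y \<in> orbit \<sigma> (p (\<sigma> y))"
    using orbit.base[of \<sigma> "p (\<sigma> y)"] inversion by simp
  then show ?case using step.IH orbit_eq_iff by metis
qed

lemma p_image_orbit: "p ` orbit \<sigma> x = orbit \<sigma> (p x)"
proof
  show "p ` orbit \<sigma> x \<subseteq> orbit \<sigma> (p x)" using p_in_orbit by auto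
  show "orbit \<sigma> (p x) \<subseteq> p ` orbit \<sigma> x"
    using p_in_orbit[of _ "p x"] involution by (metis image_eqI subsetI)
qed

lemma card_orbit_p: "card (orbit \<sigma> (p x)) = card (orbit \<sigma> x)"
  using card_image[OF permutes_inj_on[OF p]] p_image_orbit by metis

lemma funpow_inversion: "(\<sigma> ^^ i) (p ((\<sigma> ^^ i) x)) = p x"
proof (induction i)
  case (Suc i)
  have "(\<sigma> ^^ Suc i) (p ((\<sigma> ^^ Suc i) x)) = (\<sigma> ^^ i) (\<sigma> (p (\<sigma> ((\<sigma> ^^ i) x))))"
    by (simp add: funpow_swap1)
  then show ?case using Suc inversion by simp
qed simp

text \<open>The orbit of \<open>x\<close> under both \<open>\<sigma>\<close> and \<open>p\<close>: since \<open>p\<close> maps cycles of \<open>\<sigma>\<close> to cycles, it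
consists of one cycle or of two cycles exchanged by \<open>p\<close>.\<close>

definition block :: "'a \<Rightarrow> 'a set" where
  "block x = orbit \<sigma> x \<union> orbit \<sigma> (p x)"

lemma self_in_block: "x \<in> block x"
  by (simp add: block_def self_in_orbit)

lemma block_subset_X: "x \<in> X \<Longrightarrow> block x \<subseteq> X"
  unfolding block_def using orbit_subset_X permutes_in_image[OF p] by blast

lemma block_step: "block (\<sigma> x) = block x" "block (p x) = block x"
proof -
  have "orbit \<sigma> (p (\<sigma> x)) = orbit \<sigma> (p x)"
    by (rule orbit_eq[OF p_in_orbit[OF orbit.base]])
  then show "block (\<sigma> x) = block x" by (simp add: block_def orbit_step_eq)
  show "block (p x) = block x" by (auto simp: block_def involution)
qed

lemma block_eq_iff: "block y = block x \<longleftrightarrow> y \<in> block x"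
proof
  assume "y \<in> block x"
  then consider "y \<in> orbit \<sigma> x" | "y \<in> orbit \<sigma> (p x)" by (auto simp: block_def)
  then show "block y = block x"
  proof cases
    case 1
    then show ?thesis unfolding block_def using orbit_eq p_in_orbit by metis
  next
    case 2
    then show ?thesis
      unfolding block_def using orbit_eq p_in_orbit[OF 2] involution by (metis Un_commute)
  qed
qed (metis self_in_block)

text \<open>The length of the cycle through \<open>x\<close>, whether \<open>p\<close> preserves that cycle, and whether \<open>p\<close> fixes a
point of it. These data turn out to determine the block of \<open>x\<close> up to isomorphism.\<close>

definition kind :: "'a \<Rightarrow> nat \<times> bool \<times> bool" where
  "kind x = (card (orbit \<sigma> x), orbit \<sigma> (p x) = orbit \<sigma> x, \<exists>y\<in>orbit \<sigma> x. p y = y)"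

lemma kind_step: "kind (\<sigma> x) = kind x" "kind (p x) = kind x"
proof -
  show "kind (\<sigma> x) = kind x"
    unfolding kind_def orbit_step_eq
    using orbit_eq[OF p_in_orbit[OF orbit.base]] by simp
  have "(\<exists>y\<in>orbit \<sigma> (p x). p y = y) \<longleftrightarrow> (\<exists>y\<in>orbit \<sigma> x. p y = y)"
    using p_in_orbit involution by metis
  then show "kind (p x) = kind x"
    unfolding kind_def by (auto simp: card_orbit_p involution)
qed

lemma kind_block: "y \<in> block x \<Longrightarrow> kind y = kind x"
proof -
  have orb: "kind y = kind x" if "y \<in> orbit \<sigma> x" for x y
    using that by (induction) (auto simp: kind_step)
  show "y \<in> block x \<Longrightarrow> kind y = kind x"
    using orb orb[of y "p x"] by (auto simp: block_def kind_step)
qed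

lemma block_stable: "orbit \<sigma> (p x) = orbit \<sigma> x \<Longrightarrow> block x = orbit \<sigma> x"
  by (simp add: block_def)

lemma kind_fixed_imp_stable:
  assumes "\<exists>y\<in>orbit \<sigma> x. p y = y"
  shows "orbit \<sigma> (p x) = orbit \<sigma> x"
  using assms p_in_orbit orbit_eq by metis

text \<open>If \<open>p x = \<sigma>\<^sup>i x\<close>, then \<open>p\<close> maps \<open>\<sigma>\<^sup>b x\<close> to \<open>\<sigma>\<^sup>i\<^sup>-\<^sup>b x\<close>. Moving the base point by half of \<open>i\<close>
reduces \<open>i\<close> to its remainder modulo 2: remainder 0 gives a fixed point, and remainder 1 a point
that is sent to its successor. This normal form of \<open>p\<close> on a cycle makes the existence of a fixed
point the only invariant of the reflection.\<close>

lemma stable_base_point: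
  assumes "orbit \<sigma> (p x) = orbit \<sigma> x"
  obtains a where "a \<in> orbit \<sigma> x" "p a = (if \<exists>y\<in>orbit \<sigma> x. p y = y then a else \<sigma> a)"
proof (cases "\<exists>y\<in>orbit \<sigma> x. p y = y")
  case True
  then show thesis using that by auto
next
  case False
  have "p x \<in> orbit \<sigma> x" using assms self_in_orbit by metis
  then obtain i where i: "p x = (\<sigma> ^^ i) x" by (auto simp: orbit_altdef)
  define j where "j = i div 2"
  define a where "a = (\<sigma> ^^ j) x"
  have a: "a \<in> orbit \<sigma> x"
    unfolding a_def by (rule funpow_in_orbit[OF self_in_orbit])
  have "i = j + (j + i mod 2)" unfolding j_def by presburger
  then have "(\<sigma> ^^ j) (p a) = (\<sigma> ^^ (j + (j + i mod 2))) x"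
    unfolding a_def by (metis funpow_inversion i)
  also have "\<dots> = (\<sigma> ^^ j) ((\<sigma> ^^ (i mod 2)) a)"
    unfolding a_def by (simp add: funpow_add add.commute[of j "i mod 2"])
  finally have pa: "p a = (\<sigma> ^^ (i mod 2)) a"
    using permutes_inj[OF \<sigma>] by (meson inj_fn injD)
  have "i mod 2 \<noteq> 0"
  proof
    assume "i mod 2 = 0"
    then have "p a = a" using pa by simp
    then show False using False a by blast
  qed
  then have "i mod 2 = 1" by simp
  then have "p a = \<sigma> a" using pa by simp
  then show thesis using that a False by auto
qed

text \<open>If \<open>p\<close> preserves the cycle, then match the cycles along base points at which both reflections have
the same normal form; a rotation-equivariant map that respects the reflections at one point
respects them everywhere. If \<open>p\<close> exchanges two cycles, then any matching of the first two cycles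
extends uniquely to the other two by conjugating with the reflections.\<close>

lemma isomorphic_on_block:
  assumes "dihedral_action Y \<sigma>' q" and kind: "kind x = dihedral_action.kind \<sigma>' q y"
  shows "isomorphic_on \<sigma> p (block x) \<sigma>' q (dihedral_action.block \<sigma>' q y)"
proof -
  interpret B: dihedral_action Y \<sigma>' q by fact
  have card: "card (orbit \<sigma> x) = card (orbit \<sigma>' y)"
    and stable: "orbit \<sigma> (p x) = orbit \<sigma> x \<longleftrightarrow> orbit \<sigma>' (q y) = orbit \<sigma>' y"
    and fixed: "(\<exists>z\<in>orbit \<sigma> x. p z = z) \<longleftrightarrow> (\<exists>z\<in>orbit \<sigma>' y. q z = z)"
    using kind by (simp_all add: kind_def B.kind_def)
  show ?thesis
  proof (cases "orbit \<sigma> (p x) = orbit \<sigma> x")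
    case True
    then have True': "orbit \<sigma>' (q y) = orbit \<sigma>' y" using stable by simp
    obtain a where a: "a \<in> orbit \<sigma> x" "p a = (if \<exists>z\<in>orbit \<sigma> x. p z = z then a else \<sigma> a)"
      by (rule stable_base_point[OF True])
    obtain b where b: "b \<in> orbit \<sigma>' y" "q b = (if \<exists>z\<in>orbit \<sigma>' y. q z = z then b else \<sigma>' b)"
      by (rule B.stable_base_point[OF True'])
    have oa: "orbit \<sigma> a = orbit \<sigma> x" and ob: "orbit \<sigma>' b = orbit \<sigma>' y"
      using a(1) b(1) by (simp_all add: orbit_eq B.orbit_eq)
    obtain h where h: "bij_betw h (orbit \<sigma> a) (orbit \<sigma>' b)" "h a = b"
      and eq: "\<And>z. z \<in> orbit \<sigma> a \<Longrightarrow> h (\<sigma> z) = \<sigma>' (h z)"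
      by (rule ex_cycle_bijection[of a \<sigma> b \<sigma>'])
        (use oa ob card in \<open>auto simp: self_in_orbit B.self_in_orbit\<close>)
    have p_mem: "p z \<in> orbit \<sigma> a" if "z \<in> orbit \<sigma> a" for z
      using p_in_orbit[of z x] that True oa by simp
    have pa: "h (p a) = q (h a)"
      using a(2) b(2) fixed h(2) eq[OF self_in_orbit] by auto
    \<comment> \<open>Compatibility with the reflections spreads along the cycle: both sides become equal after
      applying the injective map \<open>\<sigma>'\<close>.\<close>
    have step: "h (p (\<sigma> z)) = q (h (\<sigma> z))" if z: "z \<in> orbit \<sigma> a" and IH: "h (p z) = q (h z)" for z
    proof -
      have "\<sigma>' (h (p (\<sigma> z))) = h (\<sigma> (p (\<sigma> z)))"
        using eq p_mem orbit.step[OF z] by simp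
      also have "\<dots> = q (h z)" using inversion IH by simp
      also have "\<dots> = \<sigma>' (q (h (\<sigma> z)))" using B.inversion eq[OF z] by simp
      finally show ?thesis using permutes_inj[OF B.\<sigma>] by (auto dest: injD)
    qed
    have "h (p z) = q (h z)" if "z \<in> orbit \<sigma> a" for z
      using that by (induction) (auto intro: step pa self_in_orbit)
    then show ?thesis
      unfolding isomorphic_on_def block_stable[OF True] B.block_stable[OF True']
      using h(1) eq oa ob by (intro exI[of _ h]) auto
  next
    case False
    then have False': "orbit \<sigma>' (q y) \<noteq> orbit \<sigma>' y" using stable by simp
    obtain h where h: "bij_betw h (orbit \<sigma> x) (orbit \<sigma>' y)"
      and eq: "\<And>z. z \<in> orbit \<sigma> x \<Longrightarrow> h (\<sigma> z) = \<sigma>' (h z)"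
      by (rule ex_cycle_bijection[of x \<sigma> y \<sigma>'])
        (use card in \<open>auto simp: self_in_orbit B.self_in_orbit\<close>)
    define g where "g z = (if z \<in> orbit \<sigma> x then h z else q (h (p z)))" for z
    have disj: "orbit \<sigma> x \<inter> orbit \<sigma> (p x) = {}" and disj': "orbit \<sigma>' y \<inter> orbit \<sigma>' (q y) = {}"
      using False False' orbit_eq B.orbit_eq by blast+
    have p2: "p z \<in> orbit \<sigma> x" if "z \<in> orbit \<sigma> (p x)" for z
      using p_in_orbit[OF that] involution by simp
    have g2: "g z = q (h (p z))" if "z \<in> orbit \<sigma> (p x)" for z
      using that disj by (auto simp: g_def)
    have "bij_betw p (orbit \<sigma> (p x)) (orbit \<sigma> x)"
      using p_image_orbit[of "p x"] permutes_inj_on[OF p] by (simp add: bij_betw_def involution)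
    moreover have "bij_betw q (orbit \<sigma>' y) (orbit \<sigma>' (q y))"
      using B.p_image_orbit permutes_inj_on[OF B.p] by (simp add: bij_betw_def)
    ultimately have "bij_betw (q \<circ> (h \<circ> p)) (orbit \<sigma> (p x)) (orbit \<sigma>' (q y))"
      using h by (blast intro: bij_betw_trans)
    then have bij2: "bij_betw g (orbit \<sigma> (p x)) (orbit \<sigma>' (q y))"
      by (rule iffD1[OF bij_betw_cong, rotated]) (simp add: g2)
    have bij1: "bij_betw g (orbit \<sigma> x) (orbit \<sigma>' y)"
      using h by (rule iffD1[OF bij_betw_cong, rotated]) (simp add: g_def)
    have "bij_betw g (block x) (B.block y)"
      unfolding block_def B.block_def by (rule bij_betw_combine[OF bij1 bij2 disj'])
    moreover have "g (\<sigma> z) = \<sigma>' (g z) \<and> g (p z) = q (g z)" if "z \<in> block x" for z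
    proof (cases "z \<in> orbit \<sigma> x")
      case True
      then have "\<sigma> z \<in> orbit \<sigma> x" "p z \<in> orbit \<sigma> (p x)"
        using orbit.step p_in_orbit by metis+
      then show ?thesis using True eq g2 by (simp add: g_def involution)
    next
      case False
      then have z: "z \<in> orbit \<sigma> (p x)" using that by (simp add: block_def)
      have \<sigma>z: "\<sigma> z \<in> orbit \<sigma> (p x)" using z by (rule orbit.step)
      have "\<sigma>' (h (p (\<sigma> z))) = h (p z)"
        using eq[OF p2[OF \<sigma>z]] inversion by simp
      then have "q (h (p (\<sigma> z))) = \<sigma>' (q (h (p z)))"
        using B.inversion by metis
      moreover have "g (p z) = h (p z)" using p2[OF z] by (simp add: g_def)
      ultimately show ?thesis using z \<sigma>z by (simp add: g2 B.involution)
    qed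
    ultimately show ?thesis unfolding isomorphic_on_def by blast
  qed
qed

end

text \<open>Blocks of the same kind are isomorphic, hence of the same size, so the number of points of a kind
determines the number of blocks of that kind. A bijection between the blocks of each kind, filled
in with isomorphisms of blocks, is the required isomorphism.\<close>

lemma isomorphic_if_kinds_equinumerous:
  assumes "dihedral_action X \<sigma> p" and "dihedral_action Y \<sigma>' q"
    and card: "\<And>t. card {x \<in> X. dihedral_action.kind \<sigma> p x = t} =
      card {y \<in> Y. dihedral_action.kind \<sigma>' q y = t}"
  shows "isomorphic_on \<sigma> p X \<sigma>' q Y"
proof -
  interpret A: dihedral_action X \<sigma> p by fact
  interpret B: dihedral_action Y \<sigma>' q by fact
  show ?thesis
  proof (rule isomorphic_on_glue[where f = A.kind and g = B.kind])
    fix t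
    let ?S = "{x \<in> X. A.kind x = t}" and ?T = "{y \<in> Y. B.kind y = t}"
    have fin: "finite ?S" "finite ?T" using A.finite_X B.finite_X by auto
    have fibreS: "{z \<in> ?S. A.block z = A.block x} = A.block x" if "x \<in> ?S" for x
      using that A.block_subset_X[of x] A.kind_block by (auto simp: A.block_eq_iff)
    have fibreT: "{z \<in> ?T. B.block z = B.block y} = B.block y" if "y \<in> ?T" for y
      using that B.block_subset_X[of y] B.kind_block by (auto simp: B.block_eq_iff)
    have iso: "isomorphic_on \<sigma> p (A.block x) \<sigma>' q (B.block y)" if "x \<in> ?S" "y \<in> ?T" for x y
      using A.isomorphic_on_block[OF assms(2)] that by simp
    then have "card (A.block x) = card (B.block y)" if "x \<in> ?S" "y \<in> ?T" for x y
      using that bij_betw_same_card unfolding isomorphic_on_def by blast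
    then have "card (A.block ` ?S) = card (B.block ` ?T)"
      by (intro card_image_eq_if_fibres[OF fin card]) (simp only: fibreS fibreT)
    then obtain \<theta> where \<theta>: "bij_betw \<theta> (A.block ` ?S) (B.block ` ?T)"
      using finite_same_card_bij fin by blast
    define g where "g y = inv_into (A.block ` ?S) \<theta> (B.block y)" for y
    have g: "g y \<in> A.block ` ?S" "\<theta> (g y) = B.block y" if "y \<in> ?T" for y
      unfolding g_def using \<theta> that
      by (auto simp: bij_betw_def intro!: inv_into_into f_inv_into_f)
    show "isomorphic_on \<sigma> p ?S \<sigma>' q ?T"
    proof (rule isomorphic_on_glue[where f = A.block and g = g])
      fix c
      show "isomorphic_on \<sigma> p {x \<in> ?S. A.block x = c} \<sigma>' q {y \<in> ?T. g y = c}"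
      proof (cases "c \<in> A.block ` ?S")
        case True
        then obtain x where x: "x \<in> ?S" "c = A.block x" by blast
        have "\<theta> c \<in> B.block ` ?T" using \<theta> True by (auto simp: bij_betw_def)
        then obtain y where y: "y \<in> ?T" "\<theta> c = B.block y" by blast
        have "g z = c \<longleftrightarrow> B.block z = B.block y" if "z \<in> ?T" for z
          unfolding y(2)[symmetric] g(2)[OF that, symmetric]
          by (rule inj_on_eq_iff[symmetric, OF bij_betw_imp_inj_on[OF \<theta>] g(1)[OF that] True])
        then have "{z \<in> ?T. g z = c} = B.block y"
          using fibreT[OF y(1)] by blast
        then show ?thesis using fibreS[OF x(1)] x(2) iso[OF x(1) y(1)] by simp
      next
        case False
        then have "{x \<in> ?S. A.block x = c} = {}" "{y \<in> ?T. g y = c} = {}"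
          using g(1) by blast+
        then show ?thesis unfolding isomorphic_on_def by (simp only: bij_betw_def) simp
      qed
    qed (simp add: A.block_step)
  qed (simp add: A.kind_step)
qed

section \<open>Classification by counting fixed points and preserved cycles\<close>

definition cycles_of_size :: "'a set \<Rightarrow> ('a \<Rightarrow> 'a) \<Rightarrow> nat \<Rightarrow> 'a set set" where
  "cycles_of_size X \<sigma> d = orbit \<sigma> ` {x \<in> X. card (orbit \<sigma> x) = d}"

context dihedral_action
begin

lemma stable_cycles_eq:
  "{c \<in> cycles_of_size X \<sigma> d. p ` c = c} =
    orbit \<sigma> ` {x \<in> X. card (orbit \<sigma> x) = d \<and> orbit \<sigma> (p x) = orbit \<sigma> x}"
  unfolding cycles_of_size_def by (fold p_image_orbit) blast

text \<open>Counting cycles with a fixed point is thus the same as counting fixed points of \<open>p\<close>, grouped by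
the cycle that contains them.\<close>

lemma cycles_with_fixed_point:
  "orbit \<sigma> ` {x \<in> X. card (orbit \<sigma> x) = d \<and> p x = x} = orbit \<sigma> ` {x \<in> X. kind x = (d, True, True)}"
proof (intro equalityI subsetI)
  fix c assume "c \<in> orbit \<sigma> ` {x \<in> X. card (orbit \<sigma> x) = d \<and> p x = x}"
  then obtain x where x: "x \<in> X" "card (orbit \<sigma> x) = d" "p x = x" "c = orbit \<sigma> x" by blast
  have "kind x = (d, True, True)"
    unfolding kind_def using x bexI[of "\<lambda>y. p y = y", OF x(3) self_in_orbit] by simp
  then show "c \<in> orbit \<sigma> ` {x \<in> X. kind x = (d, True, True)}"
    using x by simp
next
  fix c assume "c \<in> orbit \<sigma> ` {x \<in> X. kind x = (d, True, True)}"
  then obtain x where x: "x \<in> X" "kind x = (d, True, True)" "c = orbit \<sigma> x" by blast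
  then obtain y where y: "y \<in> orbit \<sigma> x" "p y = y" by (auto simp: kind_def)
  have "orbit \<sigma> y = orbit \<sigma> x" by (rule orbit_eq[OF y(1)])
  moreover have "y \<in> X" using orbit_subset_X[OF x(1)] y(1) by blast
  ultimately show "c \<in> orbit \<sigma> ` {x \<in> X. card (orbit \<sigma> x) = d \<and> p x = x}"
    using x y by (intro image_eqI[of _ _ y]) (simp_all add: kind_def)
qed

lemma card_stable_kind:
  "card {x \<in> X. kind x = (d, True, b)} = d * card (orbit \<sigma> ` {x \<in> X. kind x = (d, True, b)})"
proof (rule card_image_times_fibre)
  fix x assume x: "x \<in> {x \<in> X. kind x = (d, True, b)}"
  then have "block x = orbit \<sigma> x" by (intro block_stable) (simp add: kind_def)
  then have "{z \<in> {x \<in> X. kind x = (d, True, b)}. orbit \<sigma> z = orbit \<sigma> x} = orbit \<sigma> x"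
    using x kind_block[of _ x] orbit_subset_X[of x] by (auto simp: orbit_eq_iff)
  then show "card {z \<in> {x \<in> X. kind x = (d, True, b)}. orbit \<sigma> z = orbit \<sigma> x} = d"
    using x by (simp add: kind_def)
qed (simp add: finite_X)

lemma card_stable_cycles:
  "card {c \<in> cycles_of_size X \<sigma> d. p ` c = c} =
    card (orbit \<sigma> ` {x \<in> X. kind x = (d, True, True)}) +
    card (orbit \<sigma> ` {x \<in> X. kind x = (d, True, False)})"
proof -
  have "{x \<in> X. card (orbit \<sigma> x) = d \<and> orbit \<sigma> (p x) = orbit \<sigma> x} =
      {x \<in> X. kind x = (d, True, True)} \<union> {x \<in> X. kind x = (d, True, False)}"
    by (auto simp: kind_def)
  then have "{c \<in> cycles_of_size X \<sigma> d. p ` c = c} =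
      orbit \<sigma> ` {x \<in> X. kind x = (d, True, True)} \<union> orbit \<sigma> ` {x \<in> X. kind x = (d, True, False)}"
    by (simp only: stable_cycles_eq image_Un)
  moreover have "orbit \<sigma> ` {x \<in> X. kind x = (d, True, True)} \<inter>
      orbit \<sigma> ` {x \<in> X. kind x = (d, True, False)} = {}"
    by (auto simp: kind_def)
  ultimately show ?thesis
    using finite_X by (simp add: card_Un_disjoint)
qed

lemma card_points_of_kind:
  "card {x \<in> X. card (orbit \<sigma> x) = d} = card {x \<in> X. kind x = (d, True, True)} +
    card {x \<in> X. kind x = (d, True, False)} + card {x \<in> X. kind x = (d, False, False)}"
proof -
  have split: "{x \<in> X. card (orbit \<sigma> x) = d} = ({x \<in> X. kind x = (d, True, True)} \<union>
      {x \<in> X. kind x = (d, True, False)}) \<union> {x \<in> X. kind x = (d, False, False)}"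
    using kind_fixed_imp_stable unfolding kind_def by auto
  show ?thesis
    unfolding split using finite_X by (subst card_Un_disjoint; (auto)?)+
qed

lemma no_unstable_fixed: "{x \<in> X. kind x = (d, False, True)} = {}"
  using kind_fixed_imp_stable unfolding kind_def by auto

end

text \<open>For a given length \<open>d\<close>, all cycles that contain a fixed point of the reflection contain equally
many of them, for \<open>p\<close> as well as for \<open>q\<close>, because their blocks are isomorphic. So the number of
fixed points determines the number of these cycles. The number of preserved cycles then gives the
number of those without a fixed point, and the points that remain lie in exchanged cycles. Hence
all kinds occur equally often.\<close>

lemma isomorphic_if_same_counts:
  assumes "dihedral_action X \<sigma> p" and "dihedral_action X \<sigma> q"
    and fixed: "\<And>d. card {x \<in> X. card (orbit \<sigma> x) = d \<and> p x = x} =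
      card {x \<in> X. card (orbit \<sigma> x) = d \<and> q x = x}"
    and stable: "\<And>d. card {c \<in> cycles_of_size X \<sigma> d. p ` c = c} =
      card {c \<in> cycles_of_size X \<sigma> d. q ` c = c}"
  shows "isomorphic_on \<sigma> p X \<sigma> q X"
proof -
  interpret A: dihedral_action X \<sigma> p by fact
  interpret B: dihedral_action X \<sigma> q by fact
  have F: "card (orbit \<sigma> ` {x \<in> X. A.kind x = (d, True, True)}) =
      card (orbit \<sigma> ` {x \<in> X. B.kind x = (d, True, True)})" for d
    unfolding A.cycles_with_fixed_point[symmetric] B.cycles_with_fixed_point[symmetric]
  proof (rule card_image_eq_if_fibres)
    fix x y
    assume x: "x \<in> {x \<in> X. card (orbit \<sigma> x) = d \<and> p x = x}"
      and y: "y \<in> {x \<in> X. card (orbit \<sigma> x) = d \<and> q x = x}"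
    have "A.block x = orbit \<sigma> x" "B.block y = orbit \<sigma> y"
      using x y by (simp_all add: A.block_def B.block_def)
    moreover have "A.kind x = B.kind y"
      using x y A.self_in_orbit unfolding A.kind_def B.kind_def by auto
    ultimately obtain h where h: "bij_betw h (orbit \<sigma> x) (orbit \<sigma> y)"
      and hp: "\<And>z. z \<in> orbit \<sigma> x \<Longrightarrow> h (p z) = q (h z)"
      using A.isomorphic_on_block[OF assms(2), of x y] unfolding isomorphic_on_def by auto
    have px: "p z \<in> orbit \<sigma> x" if "z \<in> orbit \<sigma> x" for z
      using A.p_in_orbit[OF that] x by simp
    have "q (h z) = h z \<longleftrightarrow> p z = z" if "z \<in> orbit \<sigma> x" for z
      using inj_on_eq_iff[OF bij_betw_imp_inj_on[OF h] px[OF that] that] hp[OF that] by simp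
    then have "h ` {z \<in> orbit \<sigma> x. p z = z} = {z \<in> h ` orbit \<sigma> x. q z = z}"
      by blast
    then have "h ` {z \<in> orbit \<sigma> x. p z = z} = {z \<in> orbit \<sigma> y. q z = z}"
      unfolding bij_betw_imp_surj_on[OF h] .
    then have "bij_betw h {z \<in> orbit \<sigma> x. p z = z} {z \<in> orbit \<sigma> y. q z = z}"
      using h by (auto simp: bij_betw_def intro: inj_on_subset)
    then have "card {z \<in> orbit \<sigma> x. p z = z} = card {z \<in> orbit \<sigma> y. q z = z}"
      by (rule bij_betw_same_card)
    moreover have "{z \<in> {x \<in> X. card (orbit \<sigma> x) = d \<and> p x = x}. orbit \<sigma> z = orbit \<sigma> x} =
        {z \<in> orbit \<sigma> x. p z = z}"
      using x A.orbit_subset_X[of x] by (auto simp: A.orbit_eq_iff A.orbit_eq[of _ x])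
    moreover have "{z \<in> {x \<in> X. card (orbit \<sigma> x) = d \<and> q x = x}. orbit \<sigma> z = orbit \<sigma> y} =
        {z \<in> orbit \<sigma> y. q z = z}"
      using y A.orbit_subset_X[of y] by (auto simp: A.orbit_eq_iff A.orbit_eq[of _ y])
    ultimately show "card {z \<in> {x \<in> X. card (orbit \<sigma> x) = d \<and> p x = x}. orbit \<sigma> z = orbit \<sigma> x} =
        card {z \<in> {x \<in> X. card (orbit \<sigma> x) = d \<and> q x = x}. orbit \<sigma> z = orbit \<sigma> y}"
      by simp
  qed (use A.finite_X fixed in auto)
  have N: "card (orbit \<sigma> ` {x \<in> X. A.kind x = (d, True, False)}) =
      card (orbit \<sigma> ` {x \<in> X. B.kind x = (d, True, False)})" for d
    using stable[of d] F[of d] by (simp add: A.card_stable_cycles B.card_stable_cycles)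
  have T: "card {x \<in> X. A.kind x = (d, True, b)} = card {x \<in> X. B.kind x = (d, True, b)}" for d b
    unfolding A.card_stable_kind B.card_stable_kind using F[of d] N[of d] by (cases b) auto
  have "card {x \<in> X. A.kind x = (d, False, False)} = card {x \<in> X. B.kind x = (d, False, False)}" for d
    using A.card_points_of_kind[of d] B.card_points_of_kind[of d] T[of d True] T[of d False] by simp
  then have "card {x \<in> X. A.kind x = (d, a, b)} = card {x \<in> X. B.kind x = (d, a, b)}" for d a b
    using T by (cases a; cases b) (simp_all only: A.no_unstable_fixed B.no_unstable_fixed)
  then show ?thesis
    using assms(1,2) by (intro isomorphic_if_kinds_equinumerous) (auto simp: split_paired_all)
qed

section \<open>Products of permutations with disjoint supports\<close>

lemma perm_prod_0: "perm_prod f 0 = id"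
  by (simp add: perm_prod_def)

lemma perm_prod_Suc: "perm_prod f (Suc l) = perm_prod f l \<circ> f (Suc l)"
proof -
  have "foldr (\<circ>) xs g = foldr (\<circ>) xs id \<circ> g" for xs :: "(nat \<Rightarrow> nat) list" and g
    by (induction xs) (simp_all add: o_assoc)
  from this[of "map f [1..<Suc l]" "f (Suc l)"] show ?thesis
    by (simp add: perm_prod_def)
qed

lemma perm_prod_outside:
  assumes "\<And>i. i \<in> {1..l} \<Longrightarrow> f i permutes A i" "\<And>i. i \<in> {1..l} \<Longrightarrow> x \<notin> A i"
  shows "perm_prod f l x = x"
  using assms
proof (induction l)
  case (Suc l)
  have "f (Suc l) x = x"
    using Suc.prems by (intro permutes_not_in[of _ "A (Suc l)"]) auto
  then show ?case using Suc by (simp add: perm_prod_Suc)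
qed (simp add: perm_prod_0)

lemma perm_prod_inside:
  assumes "\<And>i. i \<in> {1..l} \<Longrightarrow> f i permutes A i"
    and "\<And>i j. i \<in> {1..l} \<Longrightarrow> j \<in> {1..l} \<Longrightarrow> i \<noteq> j \<Longrightarrow> A i \<inter> A j = {}"
    and "i \<in> {1..l}" "x \<in> A i"
  shows "perm_prod f l x = f i x"
  using assms
proof (induction l)
  case (Suc l)
  show ?case
  proof (cases "i = Suc l")
    case True
    have "f i x \<in> A i"
      using Suc.prems(1)[OF Suc.prems(3)] Suc.prems(4) by (simp add: permutes_in_image)
    then have "f i x \<notin> A j" if "j \<in> {1..l}" for j
      using Suc.prems(2)[of i j] True that by auto
    then have "perm_prod f l (f i x) = f i x"
      using Suc.prems(1) by (intro perm_prod_outside[of l f A]) auto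
    then show ?thesis by (simp add: perm_prod_Suc True)
  next
    case False
    then have i: "i \<in> {1..l}" using Suc.prems(3) by auto
    then have "x \<notin> A (Suc l)" using Suc.prems(2)[of i "Suc l"] Suc.prems(4) by auto
    then have "f (Suc l) x = x"
      using Suc.prems(1)[of "Suc l"] by (auto intro: permutes_not_in)
    moreover have "perm_prod f l x = f i x"
    proof (rule Suc.IH)
      show "f j permutes A j" if "j \<in> {1..l}" for j using Suc.prems(1)[of j] that by simp
      show "A j \<inter> A j' = {}" if "j \<in> {1..l}" "j' \<in> {1..l}" "j \<noteq> j'" for j j'
        using Suc.prems(2)[of j j'] that by simp
    qed (use i Suc.prems(4) in auto)
    ultimately show ?thesis by (simp add: perm_prod_Suc)
  qed
qed simp

text \<open>The factors \<open>\<mu>\<close> and \<open>\<pi> i\<close> of the image \<open>p\<close> of the reflection carry no information beyond \<open>p\<close>: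
they are its restrictions. All conditions on them can be read as conditions on \<open>p\<close>.\<close>

lemma disjoint_factors_eq_perm_restrict:
  assumes \<pi>: "\<And>i. i \<in> {1..l} \<Longrightarrow> \<pi> i permutes A i" and \<mu>: "\<mu> permutes F"
    and disj: "\<And>i j. i \<in> {1..l} \<Longrightarrow> j \<in> {1..l} \<Longrightarrow> i \<noteq> j \<Longrightarrow> A i \<inter> A j = {}"
    and F: "\<And>i. i \<in> {1..l} \<Longrightarrow> A i \<inter> F = {}"
    and p: "p = \<mu> \<circ> perm_prod \<pi> l"
  shows "\<mu> = perm_restrict p F" and "\<And>i. i \<in> {1..l} \<Longrightarrow> \<pi> i = perm_restrict p (A i)"
proof -
  show "\<mu> = perm_restrict p F"
  proof
    fix x
    show "\<mu> x = perm_restrict p F x"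
    proof (cases "x \<in> F")
      case True
      then have "x \<notin> A i" if "i \<in> {1..l}" for i using F[OF that] by blast
      then have "perm_prod \<pi> l x = x" by (intro perm_prod_outside[OF \<pi>])
      then show ?thesis using True by (simp add: p perm_restrict_simps)
    next
      case False
      then show ?thesis using permutes_not_in[OF \<mu>] by (simp add: perm_restrict_simps)
    qed
  qed
  show "\<pi> i = perm_restrict p (A i)" if i: "i \<in> {1..l}" for i
  proof
    fix x
    show "\<pi> i x = perm_restrict p (A i) x"
    proof (cases "x \<in> A i")
      case True
      have "perm_prod \<pi> l x = \<pi> i x"
        by (rule perm_prod_inside[where A = A]) (use \<pi> disj i True in auto)
      moreover have "\<pi> i x \<notin> F"
        using permutes_in_image[OF \<pi>[OF i]] True F[OF i] by blast
      ultimately show ?thesis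
        using True permutes_not_in[OF \<mu>] by (simp add: p perm_restrict_simps)
    next
      case False
      then show ?thesis using permutes_not_in[OF \<pi>[OF i]] by (simp add: perm_restrict_simps)
    qed
  qed
qed

section \<open>The cycles of a given length\<close>

text \<open>The points in cycles of length \<open>d\<close>. With \<open>d = 1\<close> these are the fixed points, which are thereby
treated on the same footing as the other cycles.\<close>

definition cycle_points :: "'a set \<Rightarrow> ('a \<Rightarrow> 'a) \<Rightarrow> nat \<Rightarrow> 'a set" where
  "cycle_points X \<sigma> d = {x \<in> X. card (orbit \<sigma> x) = d}"

lemma card_orbit_eq_1_iff:
  assumes "x \<in> orbit f x"
  shows "card (orbit f x) = 1 \<longleftrightarrow> f x = x"
proof
  assume "card (orbit f x) = 1"
  then have "orbit f x = {x}" using assms by (auto simp: card_1_singleton_iff)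
  then show "f x = x" by (simp only: orbit_eq_singleton_iff)
next
  assume "f x = x"
  then have "orbit f x = {x}" by (simp only: orbit_eq_singleton_iff)
  then show "card (orbit f x) = 1" by simp
qed

context
  fixes n :: nat and \<sigma> :: "nat \<Rightarrow> nat"
  assumes \<sigma>: "\<sigma> permutes {1..n}"
begin

lemma self_in_orbit_permutes: "x \<in> orbit \<sigma> x"
  using \<sigma> by (intro permutation_self_in_orbit) (auto simp: permutation_permutes)

lemma orbit_eq_permutes: "y \<in> orbit \<sigma> x \<Longrightarrow> orbit \<sigma> y = orbit \<sigma> x"
  by (meson cyclic_on_orbit[OF \<sigma>] orbit_cyclic_eq3 finite_atLeastAtMost)

lemma fixed_points_eq_cycle_points: "fixed_points n \<sigma> = cycle_points {1..n} \<sigma> 1"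
  unfolding fixed_points_def cycle_points_def card_orbit_eq_1_iff[OF self_in_orbit_permutes] ..

lemma moved_points_cycle:
  assumes x: "x \<in> moved_points n \<sigma>"
  shows "moved_points n (perm_restrict \<sigma> (orbit \<sigma> x)) = orbit \<sigma> x"
proof -
  have sub: "orbit \<sigma> x \<subseteq> {1..n}"
    using x by (intro permutes_orbit_subset[OF \<sigma>]) (auto simp: moved_points_def)
  have "\<sigma> y \<noteq> y" if y: "y \<in> orbit \<sigma> x" for y
  proof
    assume "\<sigma> y = y"
    then have "orbit \<sigma> y = {y}" by (simp only: orbit_eq_singleton_iff)
    then have "x = y" using orbit_eq_permutes[OF y] self_in_orbit_permutes[of x] by simp
    then show False using x \<open>\<sigma> y = y\<close> by (auto simp: moved_points_def fixed_points_def)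
  qed
  then show ?thesis
    using sub by (auto simp: moved_points_def fixed_points_def perm_restrict_def)
qed

lemma disjoint_cycle_eq_perm_restrict:
  assumes "c \<in> disjoint_cycles n \<sigma>"
  shows "c = perm_restrict \<sigma> (moved_points n c)"
  using assms by (auto simp: disjoint_cycles_def moved_points_cycle)

text \<open>A nontrivial cycle is recovered from its support by restricting \<open>\<sigma>\<close>, so that cycles as
permutations and cycles as orbits can be exchanged freely. The bound on \<open>d\<close> excludes the trivial
orbits, which are not supports.\<close>

lemma bij_betw_moved_points:
  assumes d: "d \<ge> 2"
  shows "bij_betw (moved_points n) {c \<in> disjoint_cycles n \<sigma>. card (moved_points n c) = d}
    (cycles_of_size {1..n} \<sigma> d)"
  unfolding bij_betw_def
proof
  let ?D = "{c \<in> disjoint_cycles n \<sigma>. card (moved_points n c) = d}"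
  show "inj_on (moved_points n) ?D"
  proof (rule inj_onI)
    fix a b assume "a \<in> ?D" "b \<in> ?D" "moved_points n a = moved_points n b"
    then show "a = b"
      using disjoint_cycle_eq_perm_restrict[of a] disjoint_cycle_eq_perm_restrict[of b] by simp
  qed
  show "moved_points n ` ?D = cycles_of_size {1..n} \<sigma> d"
  proof (intro equalityI subsetI)
    fix S assume "S \<in> moved_points n ` ?D"
    then obtain x where "x \<in> moved_points n \<sigma>" "S = orbit \<sigma> x" "card S = d"
      by (auto simp: disjoint_cycles_def moved_points_cycle)
    then show "S \<in> cycles_of_size {1..n} \<sigma> d"
      by (auto simp: cycles_of_size_def moved_points_def)
  next
    fix S assume "S \<in> cycles_of_size {1..n} \<sigma> d"
    then obtain x where x: "x \<in> {1..n}" "card (orbit \<sigma> x) = d" "S = orbit \<sigma> x"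
      by (auto simp: cycles_of_size_def)
    then have "\<sigma> x \<noteq> x"
      using d card_orbit_eq_1_iff[OF self_in_orbit_permutes, of x] by auto
    then have m: "x \<in> moved_points n \<sigma>" using x by (auto simp: moved_points_def fixed_points_def)
    show "S \<in> moved_points n ` ?D"
    proof (rule image_eqI)
      show "S = moved_points n (perm_restrict \<sigma> (orbit \<sigma> x))"
        using m x by (simp add: moved_points_cycle)
      show "perm_restrict \<sigma> (orbit \<sigma> x) \<in> ?D"
        using m x by (simp add: moved_points_cycle disjoint_cycles_def)
    qed
  qed
qed

lemma disjoint_cycle_permutes:
  assumes "c \<in> disjoint_cycles n \<sigma>"
  shows "c permutes moved_points n c"
proof -
  obtain x where x: "x \<in> moved_points n \<sigma>" "c = perm_restrict \<sigma> (orbit \<sigma> x)"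
    using assms by (auto simp: disjoint_cycles_def)
  have fin: "finite (orbit \<sigma> x)" by (rule finite_orbit[OF self_in_orbit_permutes])
  have inj: "inj_on c (orbit \<sigma> x)"
    using permutes_inj[OF \<sigma>] by (auto simp: inj_on_def x(2) perm_restrict_def)
  have "c ` orbit \<sigma> x \<subseteq> orbit \<sigma> x"
    by (auto simp: x(2) perm_restrict_def intro: orbit.step)
  with fin inj have "c ` orbit \<sigma> x = orbit \<sigma> x" by (simp add: endo_inj_surj)
  then have "c permutes orbit \<sigma> x"
    using inj by (intro bij_imp_permutes) (auto simp: bij_betw_def x(2) perm_restrict_def)
  then show ?thesis using moved_points_cycle[OF x(1)] x(2) by simp
qed

lemma prod_of_cycles_eq_perm_restrict:
  assumes d: "d \<ge> 2"
    and \<tau>: "bij_betw \<tau> {1..k} {c \<in> disjoint_cycles n \<sigma>. card (moved_points n c) = d}"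
  shows "perm_prod \<tau> k = perm_restrict \<sigma> (cycle_points {1..n} \<sigma> d)"
proof
  fix x
  let ?S = "\<lambda>j. moved_points n (\<tau> j)"
  have S: "bij_betw ?S {1..k} (cycles_of_size {1..n} \<sigma> d)"
    using bij_betw_trans[OF \<tau> bij_betw_moved_points[OF d]] by (simp add: o_def)
  have mem: "\<tau> j \<in> disjoint_cycles n \<sigma>" if "j \<in> {1..k}" for j
    using \<tau> that by (auto simp: bij_betw_def)
  have orb: "?S j = orbit \<sigma> y" if "j \<in> {1..k}" "y \<in> ?S j" for j y
  proof -
    have "?S j \<in> cycles_of_size {1..n} \<sigma> d" using S that(1) by (auto simp: bij_betw_def)
    then show ?thesis using that(2) orbit_eq_permutes by (auto simp: cycles_of_size_def)
  qed
  show "perm_prod \<tau> k x = perm_restrict \<sigma> (cycle_points {1..n} \<sigma> d) x"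
  proof (cases "x \<in> cycle_points {1..n} \<sigma> d")
    case True
    then have "orbit \<sigma> x \<in> cycles_of_size {1..n} \<sigma> d"
      by (auto simp: cycle_points_def cycles_of_size_def)
    then have "orbit \<sigma> x \<in> ?S ` {1..k}" unfolding bij_betw_imp_surj_on[OF S] .
    then obtain j where j: "j \<in> {1..k}" "?S j = orbit \<sigma> x" by (elim imageE) simp
    have "perm_prod \<tau> k x = \<tau> j x"
    proof (rule perm_prod_inside[where A = ?S])
      show "?S a \<inter> ?S b = {}" if "a \<in> {1..k}" "b \<in> {1..k}" "a \<noteq> b" for a b
      proof (rule ccontr)
        assume "?S a \<inter> ?S b \<noteq> {}"
        then obtain y where "y \<in> ?S a" "y \<in> ?S b" by blast
        then have "?S a = ?S b" using orb[of a y] orb[of b y] that by simp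
        then show False using S that by (auto simp: bij_betw_def dest: inj_onD)
      qed
    qed (use j mem in \<open>auto simp: disjoint_cycle_permutes self_in_orbit_permutes\<close>)
    also have "\<dots> = perm_restrict \<sigma> (orbit \<sigma> x) x"
      using disjoint_cycle_eq_perm_restrict[OF mem[OF j(1)]] j(2) by simp
    finally show ?thesis using True by (simp add: perm_restrict_simps self_in_orbit_permutes)
  next
    case False
    have "perm_prod \<tau> k x = x"
    proof (rule perm_prod_outside[where A = ?S])
      show "x \<notin> ?S j" if j: "j \<in> {1..k}" for j
      proof
        assume x: "x \<in> ?S j"
        have "?S j \<in> cycles_of_size {1..n} \<sigma> d" using S j by (auto simp: bij_betw_def)
        then have "card (orbit \<sigma> x) = d" using orb[OF j x] by (auto simp: cycles_of_size_def)
        moreover have "x \<in> {1..n}" using x by (auto simp: moved_points_def)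
        ultimately show False using False by (simp add: cycle_points_def)
      qed
    qed (use mem in \<open>auto simp: disjoint_cycle_permutes\<close>)
    then show ?thesis using False by (simp add: perm_restrict_simps)
  qed
qed

lemma moved_points_perm_restrict_cycle_points:
  assumes "d \<ge> 2"
  shows "moved_points n (perm_restrict \<sigma> (cycle_points {1..n} \<sigma> d)) = cycle_points {1..n} \<sigma> d"
proof -
  have "\<sigma> x \<noteq> x" if "x \<in> cycle_points {1..n} \<sigma> d" for x
    using that assms card_orbit_eq_1_iff[OF self_in_orbit_permutes, of x]
    by (auto simp: cycle_points_def)
  then show ?thesis
    by (auto simp: moved_points_def fixed_points_def perm_restrict_def cycle_points_def)
qed

end

section \<open>The action on the indices of the cycles\<close>

context
  fixes n k :: nat and \<tau> :: "nat \<Rightarrow> nat \<Rightarrow> nat" and C :: "nat set set"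
  assumes supports: "bij_betw (\<lambda>j. moved_points n (\<tau> j)) {1..k} C"
begin

text \<open>The index of the image cycle is well defined as soon as \<open>x\<close> maps supports to supports, since the
supports of distinct indices differ.\<close>

lemma cycle_action_image:
  assumes x: "image x ` C \<subseteq> C" and j: "j \<in> {1..k}"
  shows "cycle_action n k \<tau> x j \<in> {1..k}"
    and "moved_points n (\<tau> (cycle_action n k \<tau> x j)) = x ` moved_points n (\<tau> j)"
proof -
  have "x ` moved_points n (\<tau> j) \<in> C" using x bij_betwE[OF supports] j by blast
  then obtain j' where j': "j' \<in> {1..k}" "x ` moved_points n (\<tau> j) = moved_points n (\<tau> j')"
    using supports by (auto simp: bij_betw_def)
  have "cycle_action n k \<tau> x j = j'"
    unfolding cycle_action_def if_P[OF j]
  proof (rule the_equality)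
    fix i assume "i \<in> {1..k} \<and> x ` moved_points n (\<tau> j) = moved_points n (\<tau> i)"
    then show "i = j'" using j' supports by (auto simp: bij_betw_def dest: inj_onD)
  qed (use j' in simp)
  then show "cycle_action n k \<tau> x j \<in> {1..k}"
    "moved_points n (\<tau> (cycle_action n k \<tau> x j)) = x ` moved_points n (\<tau> j)"
    using j' by simp_all
qed

lemma supports_inj:
  "i \<in> {1..k} \<Longrightarrow> j \<in> {1..k} \<Longrightarrow> moved_points n (\<tau> i) = moved_points n (\<tau> j) \<Longrightarrow> i = j"
  using supports by (auto simp: bij_betw_def dest: inj_onD)

lemma cycle_action_outside: "j \<notin> {1..k} \<Longrightarrow> cycle_action n k \<tau> x j = j"
  unfolding cycle_action_def by (rule if_not_P)

lemma cycle_action_comp: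
  assumes x: "image x ` C \<subseteq> C" and y: "image y ` C \<subseteq> C"
  shows "cycle_action n k \<tau> (x \<circ> y) = cycle_action n k \<tau> x \<circ> cycle_action n k \<tau> y"
proof
  fix j
  have xy: "image (x \<circ> y) ` C \<subseteq> C"
  proof (rule image_subsetI)
    fix c assume "c \<in> C"
    then have "x ` y ` c \<in> C" using x y by blast
    then show "(x \<circ> y) ` c \<in> C" by (simp only: image_comp)
  qed
  show "cycle_action n k \<tau> (x \<circ> y) j = (cycle_action n k \<tau> x \<circ> cycle_action n k \<tau> y) j"
  proof (cases "j \<in> {1..k}")
    case True
    note y' = cycle_action_image[OF y True]
    have "moved_points n (\<tau> (cycle_action n k \<tau> (x \<circ> y) j)) = (x \<circ> y) ` moved_points n (\<tau> j)"
      by (rule cycle_action_image(2)[OF xy True])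
    also have "\<dots> = moved_points n (\<tau> (cycle_action n k \<tau> x (cycle_action n k \<tau> y j)))"
      unfolding cycle_action_image(2)[OF x y'(1)] y'(2) by (rule image_comp[symmetric])
    finally have "cycle_action n k \<tau> (x \<circ> y) j = cycle_action n k \<tau> x (cycle_action n k \<tau> y j)"
      by (rule supports_inj[OF cycle_action_image(1)[OF xy True] cycle_action_image(1)[OF x y'(1)]])
    then show ?thesis by simp
  next
    case False
    then show ?thesis by (simp add: cycle_action_outside)
  qed
qed

lemma cycle_action_permutes:
  assumes "inj x" and x: "image x ` C \<subseteq> C"
  shows "cycle_action n k \<tau> x permutes {1..k}"
proof (rule bij_imp_permutes)
  have inj: "inj_on (cycle_action n k \<tau> x) {1..k}"
  proof (rule inj_onI)
    fix i j assume ij: "i \<in> {1..k}" "j \<in> {1..k}" "cycle_action n k \<tau> x i = cycle_action n k \<tau> x j"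
    then have "x ` moved_points n (\<tau> i) = x ` moved_points n (\<tau> j)"
      using cycle_action_image(2)[OF x ij(1)] cycle_action_image(2)[OF x ij(2)] by simp
    then show "i = j"
      using supports_inj[OF ij(1,2)] by (simp only: inj_image_eq_iff[OF \<open>inj x\<close>])
  qed
  moreover have "cycle_action n k \<tau> x ` {1..k} \<subseteq> {1..k}"
    using cycle_action_image(1)[OF x] by blast
  ultimately show "bij_betw (cycle_action n k \<tau> x) {1..k} {1..k}"
    by (simp add: bij_betw_def endo_inj_surj)
qed (rule cycle_action_outside)

lemma card_fixed_cycle_action:
  assumes x: "image x ` C \<subseteq> C"
  shows "card {j \<in> {1..k}. cycle_action n k \<tau> x j = j} = card {c \<in> C. x ` c = c}"
proof (rule bij_betw_same_card)
  let ?S = "\<lambda>j. moved_points n (\<tau> j)"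
  have iff: "cycle_action n k \<tau> x j = j \<longleftrightarrow> x ` ?S j = ?S j" if j: "j \<in> {1..k}" for j
    using cycle_action_image(2)[OF x j] supports_inj[OF cycle_action_image(1)[OF x j] j] by auto
  have C: "C = ?S ` {1..k}" using supports by (simp add: bij_betw_def)
  have "?S ` {j \<in> {1..k}. cycle_action n k \<tau> x j = j} = {c \<in> C. x ` c = c}"
    unfolding C using iff by blast
  then show "bij_betw ?S {j \<in> {1..k}. cycle_action n k \<tau> x j = j} {c \<in> C. x ` c = c}"
    using supports by (auto simp: bij_betw_def intro: inj_on_subset)
qed

end

lemma cycle_action_cong:
  assumes "\<And>j. j \<in> {1..k} \<Longrightarrow> x ` moved_points n (\<tau> j) = y ` moved_points n (\<tau> j)"
  shows "cycle_action n k \<tau> x = cycle_action n k \<tau> y"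
  unfolding cycle_action_def using assms by (intro ext if_cong) simp_all

text \<open>The conjugating permutation maps the cycles of \<open>a\<close> bijectively to those of \<open>b\<close> and keeps their
lengths.\<close>

lemma cycle_type_conj:
  assumes \<eta>: "\<eta> permutes {1..k}" and a: "a permutes {1..k}"
    and eq: "\<eta> \<circ> a = b \<circ> \<eta>"
  shows "cycle_type k a = cycle_type k b"
proof -
  have orb: "\<eta> ` orbit a j = orbit b (\<eta> j)" for j
  proof (rule orbit_inverse)
    show "j \<in> orbit a j" by (rule self_in_orbit_permutes[OF a])
    show "b (\<eta> x) = \<eta> (a x)" for x using fun_cong[OF eq, of x] by simp
  qed
  have "orbit b ` {1..k} = orbit b ` \<eta> ` {1..k}" by (simp only: permutes_image[OF \<eta>])
  also have "\<dots> = image \<eta> ` orbit a ` {1..k}" by (simp add: image_image orb)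
  finally have "cycle_type k b = image_mset card (mset_set (image \<eta> ` orbit a ` {1..k}))"
    by (simp add: cycle_type_def)
  also have "mset_set (image \<eta> ` orbit a ` {1..k}) =
      image_mset (image \<eta>) (mset_set (orbit a ` {1..k}))"
    by (rule image_mset_mset_set[symmetric])
      (simp add: inj_on_def inj_image_eq_iff[OF permutes_inj[OF \<eta>]])
  also have "image_mset card \<dots> = cycle_type k a"
    by (simp add: cycle_type_def multiset.map_comp o_def card_image[OF permutes_inj_on[OF \<eta>]])
  finally show ?thesis ..
qed

text \<open>When \<open>a\<close> is the action of a reflection on the indices of cycles, this is the number of cycles
that the reflection preserves.\<close>

lemma count_cycle_type_1:
  assumes a: "a permutes {1..k}"
  shows "count (cycle_type k a) 1 = card {j \<in> {1..k}. a j = j}"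
proof -
  have "count (cycle_type k a) 1 = card {c \<in> orbit a ` {1..k}. card c = 1}"
    by (simp add: cycle_type_def count_image_mset' eq_commute[of "Suc 0"])
  also have "{c \<in> orbit a ` {1..k}. card c = 1} = (\<lambda>j. {j}) ` {j \<in> {1..k}. a j = j}"
  proof (intro equalityI subsetI)
    fix c assume "c \<in> {c \<in> orbit a ` {1..k}. card c = 1}"
    then obtain j where j: "j \<in> {1..k}" "c = orbit a j" "card (orbit a j) = 1" by blast
    then have "a j = j" using card_orbit_eq_1_iff[OF self_in_orbit_permutes[OF a]] by blast
    moreover from this have "orbit a j = {j}" by (simp only: orbit_eq_singleton_iff)
    ultimately show "c \<in> (\<lambda>j. {j}) ` {j \<in> {1..k}. a j = j}" using j by simp
  next
    fix c assume "c \<in> (\<lambda>j. {j}) ` {j \<in> {1..k}. a j = j}"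
    then obtain j where j: "j \<in> {1..k}" "c = {j}" "a j = j" by blast
    then have "orbit a j = c" by (simp only: orbit_eq_singleton_iff)
    then have "c \<in> orbit a ` {1..k}" using j(1) by blast
    then show "c \<in> {c \<in> orbit a ` {1..k}. card c = 1}" using j(2) by simp
  qed
  also have "card \<dots> = card {j \<in> {1..k}. a j = j}"
    by (rule card_image) (simp add: inj_on_def)
  finally show ?thesis .
qed

section \<open>The quotient by the kernel\<close>

lemma moved_points_int_pow_subset:
  assumes t: "t permutes {1..n}"
  shows "moved_points n (t [^]\<^bsub>sym_group n\<^esub> (z::int)) \<subseteq> moved_points n t"
proof
  interpret group "sym_group n" by (rule sym_group_is_group)
  have tc: "t \<in> carrier (sym_group n)" using t by (simp add: sym_group_carrier)
  fix x assume x: "x \<in> moved_points n (t [^]\<^bsub>sym_group n\<^esub> z)"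
  show "x \<in> moved_points n t"
  proof (rule ccontr)
    assume "x \<notin> moved_points n t"
    then have tx: "t x = x" using x by (auto simp: moved_points_def fixed_points_def)
    have pow: "(t [^]\<^bsub>sym_group n\<^esub> (i::nat)) x = x" for i
    proof (induction i)
      case 0
      then show ?case by (simp only: nat_pow_0 sym_group_one id_apply)
    next
      case (Suc i)
      then show ?case by (simp only: nat_pow_Suc sym_group_mult comp_apply tx)
    qed
    have inv_pow: "(inv\<^bsub>sym_group n\<^esub> (t [^]\<^bsub>sym_group n\<^esub> (i::nat))) x = x" for i
    proof -
      have c: "t [^]\<^bsub>sym_group n\<^esub> i \<in> carrier (sym_group n)" by (rule nat_pow_closed[OF tc])
      show ?thesis
        unfolding sym_group_inv_equality[OF c] permutes_inv_eq[OF c[unfolded sym_group_carrier]]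
        by (rule pow)
    qed
    have "(t [^]\<^bsub>sym_group n\<^esub> z) x = x"
      by (cases "z < 0") (simp_all only: int_pow_def2 if_True if_False pow inv_pow)
    then show False using x by (auto simp: moved_points_def fixed_points_def)
  qed
qed

text \<open>The support of \<open>y\<tau>y\<^sup>-\<^sup>1\<close> is the image under \<open>y\<close> of the support of \<open>\<tau>\<close>, while a power of \<open>\<tau>\<close> moves
no new points. The two supports have the same size, so the inclusion is an equality.\<close>

lemma K_set_preserves_supports:
  assumes y: "y \<in> K_set n \<rho> k \<tau>" and j: "j \<in> {1..k}" and \<tau>: "\<tau> j permutes {1..n}"
  shows "y ` moved_points n (\<tau> j) = moved_points n (\<tau> j)"
proof -
  have yp: "y permutes moved_points n \<rho>" using y by (simp add: K_set_def H_set_def)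
  obtain z :: int
    where z: "y \<otimes>\<^bsub>sym_group n\<^esub> \<tau> j \<otimes>\<^bsub>sym_group n\<^esub> inv\<^bsub>sym_group n\<^esub> y = \<tau> j [^]\<^bsub>sym_group n\<^esub> z"
    using bspec[OF conjunct2[OF y[unfolded K_set_def mem_Collect_eq]] j] by (elim exE)
  have perm: "y permutes {1..n}"
    by (rule permutes_subset[OF yp]) (auto simp: moved_points_def)
  then have yc: "y \<in> carrier (sym_group n)" by (simp add: sym_group_carrier)
  have eq: "\<tau> j [^]\<^bsub>sym_group n\<^esub> z = y \<circ> \<tau> j \<circ> inv' y"
    using z[symmetric] unfolding sym_group_mult sym_group_inv_equality[OF yc] .
  have "y ` moved_points n (\<tau> j) \<subseteq> moved_points n (\<tau> j [^]\<^bsub>sym_group n\<^esub> z)"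
  proof
    fix v assume "v \<in> y ` moved_points n (\<tau> j)"
    then obtain u where "u \<in> moved_points n (\<tau> j)" "v = y u" by blast
    then have u: "u \<in> {1..n}" "\<tau> j u \<noteq> u" "v = y u"
      by (auto simp: moved_points_def fixed_points_def)
    have "(\<tau> j [^]\<^bsub>sym_group n\<^esub> z) v = y (\<tau> j u)"
      by (simp add: eq u(3) permutes_inverses[OF perm])
    also have "\<dots> \<noteq> v" using u(2) by (simp add: u(3) inj_eq[OF permutes_inj[OF perm]])
    finally have ne: "(\<tau> j [^]\<^bsub>sym_group n\<^esub> z) v \<noteq> v" .
    have "v \<in> {1..n}" unfolding u(3) permutes_in_image[OF perm] by (rule u(1))
    then show "v \<in> moved_points n (\<tau> j [^]\<^bsub>sym_group n\<^esub> z)"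
      using ne by (simp add: moved_points_def fixed_points_def)
  qed
  also have "\<dots> \<subseteq> moved_points n (\<tau> j)" by (rule moved_points_int_pow_subset[OF \<tau>])
  finally have "y ` moved_points n (\<tau> j) \<subseteq> moved_points n (\<tau> j)" .
  moreover have "finite (moved_points n (\<tau> j))" by (simp add: moved_points_def)
  ultimately show ?thesis
    by (intro endo_inj_surj permutes_inj_on[OF perm])
qed

text \<open>Elements of the kernel preserve every support, so the action is constant on a coset and the
induced map takes the coset of \<open>x\<close> to the action of \<open>x\<close> itself. The identity is in the kernel,
which makes the coset nonempty.\<close>

lemma induced_map_quotient_image:
  assumes \<rho>: "\<rho> permutes {1..n}" and \<tau>: "\<And>j. j \<in> {1..k} \<Longrightarrow> \<tau> j permutes {1..n}"
  shows "induced_map n k \<tau> (quotient_image n \<rho> k \<tau> x) = cycle_action n k \<tau> x"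
proof -
  interpret group "sym_group n" by (rule sym_group_is_group)
  have "cycle_action n k \<tau> (y \<circ> x) = cycle_action n k \<tau> x" if y: "y \<in> K_set n \<rho> k \<tau>" for y
  proof -
    have "inj y"
      using y by (auto simp: K_set_def H_set_def intro: permutes_inj)
    have iff: "(y \<circ> x) ` moved_points n (\<tau> j) = moved_points n (\<tau> j') \<longleftrightarrow>
        x ` moved_points n (\<tau> j) = moved_points n (\<tau> j')" if j': "j' \<in> {1..k}" for j j'
    proof -
      have "y ` moved_points n (\<tau> j') = moved_points n (\<tau> j')"
        by (rule K_set_preserves_supports[where \<tau> = \<tau>, OF y j' \<tau>[OF j']])
      then have "(y \<circ> x) ` moved_points n (\<tau> j) = moved_points n (\<tau> j') \<longleftrightarrow>
          y ` x ` moved_points n (\<tau> j) = y ` moved_points n (\<tau> j')"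
        by (simp only: image_comp)
      then show ?thesis by (simp only: inj_image_eq_iff[OF \<open>inj y\<close>])
    qed
    show ?thesis
      unfolding cycle_action_def by (simp only: iff cong: conj_cong)
  qed
  then have "(\<lambda>y. cycle_action n k \<tau> (y \<circ> x)) ` K_set n \<rho> k \<tau> =
      (\<lambda>_. cycle_action n k \<tau> x) ` K_set n \<rho> k \<tau>"
    by (intro image_cong) simp_all
  moreover have "id \<in> K_set n \<rho> k \<tau>"
  proof -
    have one: "id \<otimes>\<^bsub>sym_group n\<^esub> t \<otimes>\<^bsub>sym_group n\<^esub> inv\<^bsub>sym_group n\<^esub> id = t [^]\<^bsub>sym_group n\<^esub> (1::int)"
      if "t permutes {1..n}" for t
    proof -
      have "t [^]\<^bsub>sym_group n\<^esub> (1::int) = t"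
        using that by (intro int_pow_1) (simp add: sym_group_carrier)
      moreover have "inv\<^bsub>sym_group n\<^esub> id = id"
        using inv_one by (simp add: sym_group_one)
      ultimately show ?thesis by (simp add: sym_group_mult)
    qed
    show ?thesis
      unfolding K_set_def H_set_def using one \<rho> \<tau> by (auto simp: permutes_id)
  qed
  moreover have "quotient_image n \<rho> k \<tau> x = (\<lambda>y. y \<circ> x) ` K_set n \<rho> k \<tau>"
    by (simp add: quotient_image_def r_coset_def H_group_def sym_group_mult UNION_singleton_eq_range)
  ultimately have "cycle_action n k \<tau> ` quotient_image n \<rho> k \<tau> x = {cycle_action n k \<tau> x}"
    by (simp only: image_image) blast
  then show ?thesis by (simp add: induced_map_def)
qed

section \<open>Conjugacy\<close>

text \<open>The elements on which \<open>\<psi>\<close> agrees with the conjugate of \<open>\<phi>\<close> by \<open>h\<close> form a subgroup.\<close>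

lemma conjugate_homs_iff_generators:
  assumes "group G" "group H" and \<phi>: "\<phi> \<in> hom G H" and \<psi>: "\<psi> \<in> hom G H"
    and S: "generate G S = carrier G"
  shows "conjugate_homs G H \<phi> \<psi> \<longleftrightarrow>
    (\<exists>h\<in>carrier H. \<forall>g\<in>S. h \<otimes>\<^bsub>H\<^esub> \<phi> g \<otimes>\<^bsub>H\<^esub> inv\<^bsub>H\<^esub> h = \<psi> g)"
proof -
  interpret G: group G by fact
  interpret H: group H by fact
  interpret \<phi>: group_hom G H \<phi>
    using \<phi> by (simp add: group_hom_def group_hom_axioms_def G.group_axioms H.group_axioms)
  interpret \<psi>: group_hom G H \<psi>
    using \<psi> by (simp add: group_hom_def group_hom_axioms_def G.group_axioms H.group_axioms)
  have SG: "S \<subseteq> carrier G" using S generate.incl[of _ S G] by auto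
  have ext: "h \<otimes>\<^bsub>H\<^esub> \<phi> g \<otimes>\<^bsub>H\<^esub> inv\<^bsub>H\<^esub> h = \<psi> g"
    if h: "h \<in> carrier H" and gens: "\<forall>g\<in>S. h \<otimes>\<^bsub>H\<^esub> \<phi> g \<otimes>\<^bsub>H\<^esub> inv\<^bsub>H\<^esub> h = \<psi> g"
      and g: "g \<in> carrier G" for h g
  proof -
    have eq: "h \<otimes>\<^bsub>H\<^esub> \<phi> g = \<psi> g \<otimes>\<^bsub>H\<^esub> h" if "g \<in> S" for g
    proof -
      have "\<psi> g \<otimes>\<^bsub>H\<^esub> h = h \<otimes>\<^bsub>H\<^esub> \<phi> g \<otimes>\<^bsub>H\<^esub> inv\<^bsub>H\<^esub> h \<otimes>\<^bsub>H\<^esub> h"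
        using gens that by simp
      also have "\<dots> = h \<otimes>\<^bsub>H\<^esub> \<phi> g"
        using h that SG by (simp add: H.m_assoc subsetD)
      finally show ?thesis ..
    qed
    have "g \<in> generate G S" using g S by simp
    then have "g \<in> carrier G \<and> h \<otimes>\<^bsub>H\<^esub> \<phi> g = \<psi> g \<otimes>\<^bsub>H\<^esub> h"
    proof induction
      case one
      then show ?case using h by simp
    next
      case (incl g)
      then show ?case using eq SG by blast
    next
      case (inv g)
      then have gc: "g \<in> carrier G" using SG by blast
      have "h \<otimes>\<^bsub>H\<^esub> inv\<^bsub>H\<^esub> \<phi> g = inv\<^bsub>H\<^esub> \<psi> g \<otimes>\<^bsub>H\<^esub> (\<psi> g \<otimes>\<^bsub>H\<^esub> h) \<otimes>\<^bsub>H\<^esub> inv\<^bsub>H\<^esub> \<phi> g"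
        using h gc by (simp add: H.m_assoc[symmetric])
      also have "\<dots> = inv\<^bsub>H\<^esub> \<psi> g \<otimes>\<^bsub>H\<^esub> h"
        using h gc by (simp add: eq[OF inv, symmetric] H.m_assoc)
      finally show ?case using gc by simp
    next
      case (eng a b)
      have "h \<otimes>\<^bsub>H\<^esub> (\<phi> a \<otimes>\<^bsub>H\<^esub> \<phi> b) = (\<psi> a \<otimes>\<^bsub>H\<^esub> h) \<otimes>\<^bsub>H\<^esub> \<phi> b"
        using eng h by (simp add: H.m_assoc[symmetric])
      also have "\<dots> = \<psi> a \<otimes>\<^bsub>H\<^esub> (\<psi> b \<otimes>\<^bsub>H\<^esub> h)"
        using eng h by (simp add: H.m_assoc)
      finally show ?case using eng h by (simp add: H.m_assoc)
    qed
    then show ?thesis using h g by (simp add: H.m_assoc)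
  qed
  show ?thesis
    unfolding conjugate_homs_def using ext SG by blast
qed

lemma sym_group_conj_eq_iff:
  assumes h: "h permutes {1..n}"
  shows "h \<otimes>\<^bsub>sym_group n\<^esub> x \<otimes>\<^bsub>sym_group n\<^esub> inv\<^bsub>sym_group n\<^esub> h = y \<longleftrightarrow> (\<forall>t. h (x t) = y (h t))"
proof -
  have hc: "h \<in> carrier (sym_group n)" using h by (simp add: sym_group_carrier)
  have "h \<circ> x \<circ> inv' h = y \<longleftrightarrow> (\<forall>t. h (x t) = y (h t))"
  proof
    assume "h \<circ> x \<circ> inv' h = y"
    then show "\<forall>t. h (x t) = y (h t)" by (auto simp: permutes_inverses[OF h])
  next
    assume "\<forall>t. h (x t) = y (h t)"
    then show "h \<circ> x \<circ> inv' h = y" by (auto simp: fun_eq_iff permutes_inverses[OF h])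
  qed
  then show ?thesis by (simp add: sym_group_mult sym_group_inv_equality[OF hc])
qed

lemma conjugate_in_sym_group_iff:
  "conjugate_in (sym_group n) x y \<longleftrightarrow> (\<exists>h. h permutes {1..n} \<and> (\<forall>t. h (x t) = y (h t)))"
  unfolding conjugate_in_def Bex_def sym_group_carrier
  by (simp only: sym_group_conj_eq_iff cong: conj_cong)

lemma card_fixed_eq_if_conjugate:
  assumes h: "h permutes X" and eq: "\<And>t. h (x t) = y (h t)"
  shows "card {t \<in> X. x t = t} = card {t \<in> X. y t = t}"
proof (rule bij_betw_same_card)
  have iff: "y (h t) = h t \<longleftrightarrow> x t = t" for t
    using inj_eq[OF permutes_inj[OF h], of "x t" t] eq[of t] by simp
  have "h ` {t \<in> X. x t = t} = {t \<in> h ` X. y t = t}" using iff by blast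
  then show "bij_betw h {t \<in> X. x t = t} {t \<in> X. y t = t}"
    using permutes_image[OF h] by (simp add: bij_betw_def permutes_inj_on[OF h])
qed

lemma card_fixed_perm_restrict:
  assumes "finite X" "A \<subseteq> X"
  shows "card {t \<in> X. perm_restrict p A t = t} = card {t \<in> A. p t = t} + card (X - A)"
proof -
  have "{t \<in> X. perm_restrict p A t = t} = {t \<in> A. p t = t} \<union> (X - A)"
    using assms(2) by (auto simp: perm_restrict_def)
  then show ?thesis
    using assms by (simp add: card_Un_disjoint[of "{t \<in> A. p t = t}" "X - A"] finite_subset disjoint_iff)
qed

section \<open>Homomorphisms from the dihedral group\<close>

lemma dihedral_hom_action:
  assumes \<phi>: "\<phi> \<in> hom (dihedral_group m) (sym_group n)"
  shows "dihedral_action {1..n} (\<phi> (dihedral_r m)) (\<phi> (dihedral_s m))"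
proof -
  let ?c = "pres_class (dihedral_relations m)" and ?G = "dihedral_group m"
  interpret G: group ?G by (rule group_dihedral_group)
  interpret group_hom ?G "sym_group n" \<phi>
    using \<phi> by (simp add: group_hom_def group_hom_axioms_def G.group_axioms sym_group_is_group)
  have mult: "?c u \<otimes>\<^bsub>?G\<^esub> ?c v = ?c (u @ v)" for u v
    by (simp add: dihedral_group_def presented_group_mult)
  have one: "\<one>\<^bsub>?G\<^esub> = ?c []"
    by (simp add: dihedral_group_def presented_group_one)
  have rc: "dihedral_r m \<in> carrier ?G" and sc: "dihedral_s m \<in> carrier ?G"
    by (simp_all add: dihedral_r_def dihedral_s_def dihedral_group_def presented_group_carrier)
  let ?\<sigma> = "\<phi> (dihedral_r m)" and ?p = "\<phi> (dihedral_s m)"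
  have "pres_eq (dihedral_relations m) [(Refl, True), (Refl, True)] []"
    by (rule pres_eq.relation) (simp add: dihedral_relations_def)
  then have "dihedral_s m \<otimes>\<^bsub>?G\<^esub> dihedral_s m = \<one>\<^bsub>?G\<^esub>"
    by (simp add: dihedral_s_def mult one pres_class_eq_iff)
  then have "\<phi> (dihedral_s m \<otimes>\<^bsub>?G\<^esub> dihedral_s m) = \<phi> \<one>\<^bsub>?G\<^esub>" by simp
  then have pp: "?p \<circ> ?p = id"
    using sc by (simp add: sym_group_mult sym_group_one)
  have rel: "pres_eq (dihedral_relations m)
      [(Refl, True), (Rot, True), (Refl, True)] [(Rot, False)]"
    by (rule pres_eq.relation) (simp add: dihedral_relations_def)
  have "pres_eq (dihedral_relations m)
      ([(Rot, True)] @ [(Refl, True), (Rot, True), (Refl, True)]) ([(Rot, True)] @ [(Rot, False)])"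
    by (rule pres_eq.append[OF pres_eq.refl rel])
  then have "pres_eq (dihedral_relations m)
      ([(Rot, True)] @ [(Refl, True), (Rot, True), (Refl, True)]) []"
    using pres_eq.trans[OF _ pres_eq.cancel[of _ Rot True]] by simp
  then have "dihedral_r m \<otimes>\<^bsub>?G\<^esub> dihedral_s m \<otimes>\<^bsub>?G\<^esub> dihedral_r m \<otimes>\<^bsub>?G\<^esub> dihedral_s m = \<one>\<^bsub>?G\<^esub>"
    by (simp add: dihedral_r_def dihedral_s_def mult one pres_class_eq_iff)
  then have "\<phi> (dihedral_r m \<otimes>\<^bsub>?G\<^esub> dihedral_s m \<otimes>\<^bsub>?G\<^esub> dihedral_r m \<otimes>\<^bsub>?G\<^esub> dihedral_s m) = \<phi> \<one>\<^bsub>?G\<^esub>"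
    by simp
  then have rsrs: "?\<sigma> \<circ> ?p \<circ> ?\<sigma> \<circ> ?p = id"
    using rc sc by (simp add: sym_group_mult sym_group_one)
  show ?thesis
  proof
    show "?\<sigma> permutes {1..n}" "?p permutes {1..n}"
      using hom_closed[OF rc] hom_closed[OF sc] by (simp_all add: sym_group_carrier)
    show "?p (?p x) = x" for x using fun_cong[OF pp, of x] by simp
    then show "?\<sigma> (?p (?\<sigma> x)) = ?p x" for x using fun_cong[OF rsrs, of "?p x"] by simp
  qed simp
qed

lemma conjugate_dihedral_homs_iff:
  assumes "\<phi> \<in> hom (dihedral_group m) (sym_group n)" "\<psi> \<in> hom (dihedral_group m) (sym_group n)"
  shows "conjugate_homs (dihedral_group m) (sym_group n) \<phi> \<psi> \<longleftrightarrow>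
    (\<exists>h. h permutes {1..n} \<and>
      (\<forall>t. h (\<phi> (dihedral_r m) t) = \<psi> (dihedral_r m) (h t)) \<and>
      (\<forall>t. h (\<phi> (dihedral_s m) t) = \<psi> (dihedral_s m) (h t)))"
  unfolding conjugate_homs_iff_generators[OF group_dihedral_group sym_group_is_group assms
      generate_dihedral_group] Bex_def sym_group_carrier
  by (simp only: sym_group_conj_eq_iff ball_simps simp_thms cong: conj_cong)

section \<open>Conjugacy of homomorphisms from the dihedral group\<close>

lemma equivariant_image_cycle_points:
  assumes h: "h permutes X" and orb: "\<And>x. h ` orbit \<sigma> x = orbit \<sigma> (h x)"
  shows "h x \<in> cycle_points X \<sigma> d \<longleftrightarrow> x \<in> cycle_points X \<sigma> d"
  unfolding cycle_points_def
  using card_image[OF permutes_inj_on[OF h]] orb[symmetric] permutes_in_image[OF h] by simp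

lemma equivariant_image_cycles_of_size:
  assumes h: "h permutes X" and orb: "\<And>x. h ` orbit \<sigma> x = orbit \<sigma> (h x)"
  shows "image h ` cycles_of_size X \<sigma> d \<subseteq> cycles_of_size X \<sigma> d"
proof (rule image_subsetI)
  fix c assume "c \<in> cycles_of_size X \<sigma> d"
  then obtain x where x: "x \<in> cycle_points X \<sigma> d" "c = orbit \<sigma> x"
    by (auto simp: cycles_of_size_def cycle_points_def)
  have "h ` c = orbit \<sigma> (h x)" by (simp only: x(2) orb)
  moreover have "h x \<in> cycle_points X \<sigma> d"
    using equivariant_image_cycle_points[OF h orb] x(1) by blast
  ultimately show "h ` c \<in> cycles_of_size X \<sigma> d"
    by (auto simp: cycles_of_size_def cycle_points_def)
qed

lemma perm_restrict_commute:
  assumes "\<And>t. h (p t) = q (h t)" "\<And>t. h t \<in> A \<longleftrightarrow> t \<in> A"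
  shows "h (perm_restrict p A t) = perm_restrict q A (h t)"
  using assms by (simp add: perm_restrict_def)

text \<open>On the fixed points of \<open>\<sigma>\<close> the two counts of the classification coincide, which is why conjugacy
of \<open>\<mu>\<close> and \<open>\<mu>'\<close> suffices there.\<close>

lemma (in dihedral_action) stable_cycles_of_size_1:
  "card {c \<in> cycles_of_size X \<sigma> 1. p ` c = c} = card {x \<in> cycle_points X \<sigma> 1. p x = x}"
proof -
  have orb: "orbit \<sigma> x = {x}" if "x \<in> cycle_points X \<sigma> 1" for x
    using that card_orbit_eq_1_iff[OF self_in_orbit, of x] orbit_eq_singleton_iff[of \<sigma> x]
    unfolding cycle_points_def by blast
  then have "cycles_of_size X \<sigma> 1 = (\<lambda>x. {x}) ` cycle_points X \<sigma> 1"
    unfolding cycles_of_size_def cycle_points_def[symmetric] by (intro image_cong) auto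
  then have "{c \<in> cycles_of_size X \<sigma> 1. p ` c = c} = (\<lambda>x. {x}) ` {x \<in> cycle_points X \<sigma> 1. p x = x}"
    by auto
  then show ?thesis by (simp add: card_image)
qed

theorem theorem3p8:
  fixes m n l :: nat
    and \<phi> \<psi> :: "dihedral_gen word set \<Rightarrow> nat \<Rightarrow> nat"
    and \<sigma> \<mu> \<mu>' :: "nat \<Rightarrow> nat"
    and d k :: "nat \<Rightarrow> nat"
    and \<sigma>c \<pi> \<pi>' :: "nat \<Rightarrow> nat \<Rightarrow> nat"
    and \<tau> :: "nat \<Rightarrow> nat \<Rightarrow> nat \<Rightarrow> nat"
  assumes "m \<ge> 1"
    and "\<phi> \<in> hom (dihedral_group m) (sym_group n)"
    and "\<psi> \<in> hom (dihedral_group m) (sym_group n)"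
    and "generator_conjugate (sym_group n) {dihedral_r m, dihedral_s m} \<phi> \<psi>"
    and "\<phi> (dihedral_r m) = \<sigma>" and "\<psi> (dihedral_r m) = \<sigma>"
    and "\<And>i. i \<in> {1..l} \<Longrightarrow> d i \<ge> 2"
    and "inj_on d {1..l}"
    and "\<And>i. i \<in> {1..l} \<Longrightarrow> k i \<ge> 1"
    and "\<And>i. i \<in> {1..l} \<Longrightarrow>
      bij_betw (\<tau> i) {1..k i} {c \<in> disjoint_cycles n \<sigma>. card (moved_points n c) = d i}"
    and "\<And>i. i \<in> {1..l} \<Longrightarrow> \<sigma>c i = perm_prod (\<tau> i) (k i)"
    and "\<sigma> = perm_prod \<sigma>c l"
    and "\<mu> permutes fixed_points n \<sigma>" and "\<mu>' permutes fixed_points n \<sigma>"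
    and "\<And>i. i \<in> {1..l} \<Longrightarrow> \<pi> i \<in> H_set n (\<sigma>c i)"
    and "\<And>i. i \<in> {1..l} \<Longrightarrow> \<pi>' i \<in> H_set n (\<sigma>c i)"
    and "\<phi> (dihedral_s m) = \<mu> \<circ> perm_prod \<pi> l"
    and "\<psi> (dihedral_s m) = \<mu>' \<circ> perm_prod \<pi>' l"
  shows "conjugate_homs (dihedral_group m) (sym_group n) \<phi> \<psi> \<longleftrightarrow>
    conjugate_in (sym_group n) \<mu> \<mu>' \<and>
    (\<forall>i\<in>{1..l}.
      conjugate_in (sym_group n) (\<pi> i) (\<pi>' i) \<and>
      cycle_type (k i) (induced_map n (k i) (\<tau> i) (quotient_image n (\<sigma>c i) (k i) (\<tau> i) (\<pi> i))) =
      cycle_type (k i) (induced_map n (k i) (\<tau> i) (quotient_image n (\<sigma>c i) (k i) (\<tau> i) (\<pi>' i))))"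
proof -
  define p q where "p = \<phi> (dihedral_s m)" and "q = \<psi> (dihedral_s m)"
  let ?X = "{1..n}"
  let ?P = "cycle_points ?X \<sigma>" and ?C = "cycles_of_size ?X \<sigma>"
  interpret A: dihedral_action ?X \<sigma> p
    using dihedral_hom_action[OF assms(2)] assms(5) by (simp add: p_def)
  interpret B: dihedral_action ?X \<sigma> q
    using dihedral_hom_action[OF assms(3)] assms(6) by (simp add: q_def)
  note \<sigma> = A.\<sigma>

  have \<sigma>c: "\<sigma>c i = perm_restrict \<sigma> (?P (d i))" if "i \<in> {1..l}" for i
    unfolding assms(11)[OF that]
    by (rule prod_of_cycles_eq_perm_restrict[OF \<sigma> assms(7)[OF that] assms(10)[OF that]])
  have moved_\<sigma>c: "moved_points n (\<sigma>c i) = ?P (d i)" if "i \<in> {1..l}" for i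
    unfolding \<sigma>c[OF that]
    by (rule moved_points_perm_restrict_cycle_points[OF \<sigma> assms(7)[OF that]])
  have fixed: "fixed_points n \<sigma> = ?P 1" by (rule fixed_points_eq_cycle_points[OF \<sigma>])
  have disj: "?P (d i) \<inter> ?P (d j) = {}" if "i \<in> {1..l}" "j \<in> {1..l}" "i \<noteq> j" for i j
    using inj_onD[OF assms(8) _ that(1,2)] that(3) by (auto simp: cycle_points_def)
  have disj1: "?P (d i) \<inter> ?P 1 = {}" if "i \<in> {1..l}" for i
    using assms(7)[OF that] by (auto simp: cycle_points_def)
  have perm: "\<pi> i permutes ?P (d i)" "\<pi>' i permutes ?P (d i)" if "i \<in> {1..l}" for i
    using assms(15)[OF that] assms(16)[OF that]
    unfolding H_set_def moved_\<sigma>c[OF that] by simp_all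
  have \<mu>: "\<mu> = perm_restrict p (?P 1)" and \<pi>: "\<And>i. i \<in> {1..l} \<Longrightarrow> \<pi> i = perm_restrict p (?P (d i))"
    by (rule disjoint_factors_eq_perm_restrict[where A = "\<lambda>i. ?P (d i)" and F = "?P 1" and l = l
          and \<pi> = \<pi> and \<mu> = \<mu>];
        use perm(1) assms(13,17) disj disj1 in \<open>simp add: fixed p_def\<close>)+
  have \<mu>': "\<mu>' = perm_restrict q (?P 1)" and \<pi>': "\<And>i. i \<in> {1..l} \<Longrightarrow> \<pi>' i = perm_restrict q (?P (d i))"
    by (rule disjoint_factors_eq_perm_restrict[where A = "\<lambda>i. ?P (d i)" and F = "?P 1" and l = l
          and \<pi> = \<pi>' and \<mu> = \<mu>'];
        use perm(2) assms(14,18) disj disj1 in \<open>simp add: fixed q_def\<close>)+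

  define act where "act i x = cycle_action n (k i) (\<tau> i) x" for i x
  have supports: "bij_betw (\<lambda>j. moved_points n (\<tau> i j)) {1..k i} (?C (d i))" if "i \<in> {1..l}" for i
    using bij_betw_trans[OF assms(10)[OF that] bij_betw_moved_points[OF \<sigma> assms(7)[OF that]]]
    by (simp add: o_def)
  \<comment> \<open>On a support of length \<open>d i\<close> the factor agrees with the full reflection, so its action on
    the indices can be computed from the full reflection.\<close>
  have induced: "induced_map n (k i) (\<tau> i) (quotient_image n (\<sigma>c i) (k i) (\<tau> i) (perm_restrict x (?P (d i))))
      = act i x" if i: "i \<in> {1..l}" for i x
  proof -
    have "\<tau> i j permutes ?X" if "j \<in> {1..k i}" for j
    proof (rule permutes_subset)
      have "\<tau> i j \<in> disjoint_cycles n \<sigma>" using bij_betwE[OF assms(10)[OF i]] that by blast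
      then show "\<tau> i j permutes moved_points n (\<tau> i j)" by (rule disjoint_cycle_permutes[OF \<sigma>])
    qed (auto simp: moved_points_def)
    moreover have "\<sigma>c i permutes ?X"
    proof -
      have "perm_prod (\<tau> i) r permutes ?X" if "r \<le> k i" for r
        using that
      proof (induction r)
        case 0
        then show ?case by (simp only: perm_prod_0 permutes_id)
      next
        case (Suc r)
        then show ?case
          unfolding perm_prod_Suc using calculation[of "Suc r"] by (intro permutes_compose) auto
      qed
      then show ?thesis unfolding assms(11)[OF i] by simp
    qed
    ultimately have "induced_map n (k i) (\<tau> i)
        (quotient_image n (\<sigma>c i) (k i) (\<tau> i) (perm_restrict x (?P (d i)))) =
      cycle_action n (k i) (\<tau> i) (perm_restrict x (?P (d i)))"
      by (rule induced_map_quotient_image[rotated])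
    also have "\<dots> = act i x"
      unfolding act_def
    proof (rule cycle_action_cong)
      fix j assume "j \<in> {1..k i}"
      then have "moved_points n (\<tau> i j) \<in> ?C (d i)" using bij_betwE[OF supports[OF i]] by blast
      then obtain y where y: "y \<in> ?P (d i)" "moved_points n (\<tau> i j) = orbit \<sigma> y"
        by (auto simp: cycles_of_size_def cycle_points_def)
      have "orbit \<sigma> y \<subseteq> ?P (d i)"
        using y(1) A.orbit_subset_X[of y] A.orbit_eq[of _ y] by (auto simp: cycle_points_def)
      then show "perm_restrict x (?P (d i)) ` moved_points n (\<tau> i j) = x ` moved_points n (\<tau> i j)"
        unfolding y(2) by (intro image_cong) (auto simp: perm_restrict_simps)
    qed
    finally show ?thesis .
  qed
  have p_cycles: "image p ` ?C e \<subseteq> ?C e" and q_cycles: "image q ` ?C e \<subseteq> ?C e" for e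
    using equivariant_image_cycles_of_size[OF A.p A.p_image_orbit]
      equivariant_image_cycles_of_size[OF B.p B.p_image_orbit] by blast+
  have act_perm: "act i p permutes {1..k i}" "act i q permutes {1..k i}" if "i \<in> {1..l}" for i
    unfolding act_def
    by (rule cycle_action_permutes[OF supports[OF that]];
        rule permutes_inj[OF A.p] permutes_inj[OF B.p] p_cycles q_cycles)+

  have homs: "conjugate_homs (dihedral_group m) (sym_group n) \<phi> \<psi> \<longleftrightarrow>
    (\<exists>h. h permutes ?X \<and> (\<forall>t. h (\<sigma> t) = \<sigma> (h t)) \<and> (\<forall>t. h (p t) = q (h t)))"
    using conjugate_dihedral_homs_iff[OF assms(2,3)] unfolding assms(5,6) p_def q_def .
  have "conjugate_homs (dihedral_group m) (sym_group n) \<phi> \<psi> \<longleftrightarrow>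
    conjugate_in (sym_group n) (perm_restrict p (?P 1)) (perm_restrict q (?P 1)) \<and>
    (\<forall>i\<in>{1..l}. conjugate_in (sym_group n) (perm_restrict p (?P (d i))) (perm_restrict q (?P (d i))) \<and>
      cycle_type (k i) (act i p) = cycle_type (k i) (act i q))" (is "?L \<longleftrightarrow> ?R")
  proof
    assume ?L
    then obtain h where h: "h permutes ?X" and h\<sigma>: "\<And>t. h (\<sigma> t) = \<sigma> (h t)"
      and hp: "\<And>t. h (p t) = q (h t)"
      unfolding homs by blast
    have orb: "h ` orbit \<sigma> x = orbit \<sigma> (h x)" for x
      by (rule orbit_inverse[OF A.self_in_orbit]) (rule h\<sigma>[symmetric])
    have conj: "conjugate_in (sym_group n) (perm_restrict p (?P e)) (perm_restrict q (?P e))" for e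
      unfolding conjugate_in_sym_group_iff
      using h perm_restrict_commute[of h p q "?P e", OF hp equivariant_image_cycle_points[OF h orb]]
      by blast
    have "cycle_type (k i) (act i p) = cycle_type (k i) (act i q)" if i: "i \<in> {1..l}" for i
    proof (rule cycle_type_conj[OF _ act_perm(1)[OF i]])
      note h_cycles = equivariant_image_cycles_of_size[OF h orb, of "d i"]
      note comp = cycle_action_comp[OF supports[OF i]]
      show "act i h permutes {1..k i}"
        unfolding act_def by (rule cycle_action_permutes[OF supports[OF i] permutes_inj[OF h] h_cycles])
      have "h \<circ> p = q \<circ> h" using hp by (simp add: fun_eq_iff)
      then show "act i h \<circ> act i p = act i q \<circ> act i h"
        unfolding act_def comp[OF h_cycles p_cycles, symmetric] comp[OF q_cycles h_cycles, symmetric]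
        by simp
    qed
    then show ?R using conj by blast
  next
    assume R: ?R
    have P_sub: "?P e \<subseteq> ?X" for e by (auto simp: cycle_points_def)
    have conj_count: "card {x \<in> ?P e. p x = x} = card {x \<in> ?P e. q x = x}"
      if conj: "conjugate_in (sym_group n) (perm_restrict p (?P e)) (perm_restrict q (?P e))" for e
    proof -
      obtain h where h: "h permutes ?X"
        and eq: "\<And>t. h (perm_restrict p (?P e) t) = perm_restrict q (?P e) (h t)"
        using conj unfolding conjugate_in_sym_group_iff by blast
      show ?thesis
        using card_fixed_eq_if_conjugate[of h ?X "perm_restrict p (?P e)" "perm_restrict q (?P e)", OF h eq]
        unfolding card_fixed_perm_restrict[OF A.finite_X P_sub[of e]] by simp
    qed
    \<comment> \<open>Since \<open>\<sigma>\<close> is the product of the \<open>\<sigma>c i\<close>, every cycle of \<open>\<sigma>\<close> has length 1 or one of the \<open>d i\<close>.\<close>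
    have cover: "e = 1 \<or> e \<in> d ` {1..l}" if ne: "?P e \<noteq> {}" for e
    proof (rule ccontr)
      assume e: "\<not> (e = 1 \<or> e \<in> d ` {1..l})"
      obtain x where x: "x \<in> ?P e" using ne by blast
      have "\<sigma>c i x = x" if "i \<in> {1..l}" for i
        unfolding \<sigma>c[OF that] using x e that by (auto simp: perm_restrict_def cycle_points_def)
      then have "perm_prod \<sigma>c r x = x" if "r \<le> l" for r
        using that by (induction r) (auto simp: perm_prod_0 perm_prod_Suc)
      then have "\<sigma> x = x" using assms(12) by simp
      then have "card (orbit \<sigma> x) = 1" using card_orbit_eq_1_iff[OF A.self_in_orbit] by blast
      then show False using x e by (simp add: cycle_points_def)
    qed
    have fixed_count: "card {x \<in> ?P e. p x = x} = card {x \<in> ?P e. q x = x}" for e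
    proof (cases "?P e = {}")
      case False
      then show ?thesis using cover[OF False] R conj_count by blast
    qed simp
    have stable_count: "card {c \<in> ?C e. p ` c = c} = card {c \<in> ?C e. q ` c = c}" for e
    proof (cases "?P e = {}")
      case True
      then have "?C e = {}" unfolding cycles_of_size_def cycle_points_def[symmetric] by simp
      then show ?thesis by simp
    next
      case False
      then consider "e = 1" | i where "i \<in> {1..l}" "e = d i" using cover by blast
      then show ?thesis
      proof cases
        case 1
        then show ?thesis
          using A.stable_cycles_of_size_1 B.stable_cycles_of_size_1 fixed_count[of 1] by simp
      next
        case (2 i)
        have "cycle_type (k i) (act i p) = cycle_type (k i) (act i q)" using R 2(1) by blast
        then have "card {j \<in> {1..k i}. act i p j = j} = card {j \<in> {1..k i}. act i q j = j}"
          unfolding count_cycle_type_1[OF act_perm(1)[OF 2(1)], symmetric]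
            count_cycle_type_1[OF act_perm(2)[OF 2(1)], symmetric] by simp
        then show ?thesis
          unfolding act_def card_fixed_cycle_action[OF supports[OF 2(1)] p_cycles]
            card_fixed_cycle_action[OF supports[OF 2(1)] q_cycles] 2(2) .
      qed
    qed
    have "isomorphic_on \<sigma> p ?X \<sigma> q ?X"
    proof (rule isomorphic_if_same_counts[OF A.dihedral_action_axioms B.dihedral_action_axioms])
      show "card {x \<in> ?X. card (orbit \<sigma> x) = e \<and> p x = x} = card {x \<in> ?X. card (orbit \<sigma> x) = e \<and> q x = x}" for e
        using fixed_count[of e] by (simp add: cycle_points_def conj_assoc)
    qed (rule stable_count)
    then obtain g where g: "bij_betw g ?X ?X"
      and eq: "\<And>x. x \<in> ?X \<Longrightarrow> g (\<sigma> x) = \<sigma> (g x) \<and> g (p x) = q (g x)"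
      unfolding isomorphic_on_def by blast
    define h where "h = perm_restrict g ?X"
    have h_in: "h x = g x" if "x \<in> ?X" for x using that by (simp only: h_def perm_restrict_simps)
    have h_out: "h x = x" if "x \<notin> ?X" for x unfolding h_def by (rule perm_restrict_simps(2)[OF that])
    have "bij_betw h ?X ?X" using bij_betw_cong[THEN iffD2, OF h_in g] .
    then have "h permutes ?X" by (rule bij_imp_permutes) (rule h_out)
    moreover have "h (\<sigma> t) = \<sigma> (h t) \<and> h (p t) = q (h t)" for t
    proof (cases "t \<in> ?X")
      case True
      then have "\<sigma> t \<in> ?X" "p t \<in> ?X"
        using permutes_in_image[OF A.\<sigma>] permutes_in_image[OF A.p] by blast+
      then show ?thesis using True eq h_in by simp
    next
      case False
      then show ?thesis
        using permutes_not_in[OF A.\<sigma> False] permutes_not_in[OF A.p False]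
          permutes_not_in[OF B.p False] h_out[OF False]
        by simp
    qed
    ultimately show ?L unfolding homs by blast
  qed
  then show ?thesis
    unfolding \<mu> \<mu>' by (simp only: \<pi> \<pi>' induced cong: ball_cong)
qed

end
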